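(* Let $\Delta\subset\mathbb{R}^n$ be a simplicial complex with $m$ vertices $v_1,\dots,v_m$. Let $T_1,\dots,T_m\in\mathcal{C}^0(\Delta)$ be the tent functions on $\Delta$. If a function $F\in\mathcal{C}^0(\Delta)$ is strictly positive on $\Delta$, then there exist sums of squares $S_0,S_1,\dots,S_m$ of elements of $\mathcal{C}^0(\Delta)$ such that \[ F=S_0+\sum_{i=1}^m S_iT_i . \]
   Context: For affinely independent $v_0,\dots,v_d\in\mathbb{R}^n$, $\sigma(v_0,\dots,v_d)$ denotes the $d$-simplex that is their convex hull; its faces are the simplices spanned by subsets of $\{v_0,\dots,v_d\}$ (including the empty one). A simplicial complex in $\mathbb{R}^n$ is a finite union $\Delta=\sigma_1\cup\dots\cup\sigma_k$ of simplices such that $\sigma_i\cap\sigma_j$ is a face of both $\sigma_i$ and $\sigma_j$ for all $i,j$. The vertices of $\Delta$ are the vertices of the $\sigma_i$. $\mathcal{C}^0(\Delta)$ is the $\mathbb{R}$-algebra (under pointwise operations) of all continuous functions $F\colon\Delta\to\mathbb{R}$ for which there are polynomials $g_1,\dots,g_k\in\mathbb{R}[t_1,\dots,t_n]$ with $F|_{\sigma_i}=g_i|_{\sigma_i}$ for all $i$. The tent function $T_i$ is the unique element of $\mathcal{C}^0(\Delta)$ that is piecewise linear (i.e. affine-linear on each simplex $\sigma_j$) with $T_i(v_i)=1$ and $T_i(v_j)=0$ for $j\neq i$. *)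

theory Defs
  imports "HOL-Analysis.Analysis"
begin

(* A simplex \<sigma>(v_0,...,v_d) is represented by its vertex set {v_0,...,v_d}, and a simplicial
   complex by the set K of the vertex sets of \<sigma>_1,...,\<sigma>_k.  As a simplex determines its
   vertices, nothing is lost.  K need not be closed under taking faces, and only the chosen
   simplices, not all their faces, belong to it (hence not the library's simplicial_complex). *)

definition simplex_vertices :: "'a::euclidean_space set \<Rightarrow> bool" where
  "simplex_vertices V \<longleftrightarrow> finite V \<and> V \<noteq> {} \<and> \<not> affine_dependent V"

(* W = {} gives the empty face. *)
definition face_spanned :: "'a::euclidean_space set \<Rightarrow> 'a set \<Rightarrow> bool" where
  "face_spanned S V \<longleftrightarrow> (\<exists>W \<subseteq> V. S = convex hull W)"

definition complex_of_simplices :: "'a::euclidean_space set set \<Rightarrow> bool" where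
  "complex_of_simplices K \<longleftrightarrow>
     finite K \<and> (\<forall>V\<in>K. simplex_vertices V) \<and>
     (\<forall>V\<in>K. \<forall>W\<in>K. face_spanned (convex hull V \<inter> convex hull W) V \<and>
                   face_spanned (convex hull V \<inter> convex hull W) W)"

definition realization :: "'a::euclidean_space set set \<Rightarrow> 'a set" where
  "realization K = (\<Union>V\<in>K. convex hull V)"

definition complex_vertices :: "'a::euclidean_space set set \<Rightarrow> 'a set" where
  "complex_vertices K = \<Union>K"

(* Functions on \<Delta> are rendered as total functions that are extensional (take the value undefined
   off \<Delta>), so that HOL equality is equality of functions on \<Delta>.  On real ^ 'n, the bounded linear
   functionals generating real_polynomial_function are the linear forms in the coordinates, so
   these are exactly the functions given by polynomials in n variables. *)
definition C0 :: "'a::euclidean_space set set \<Rightarrow> ('a \<Rightarrow> real) set" where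
  "C0 K = {F \<in> extensional (realization K).
             continuous_on (realization K) F \<and>
             (\<forall>V\<in>K. \<exists>g. real_polynomial_function g \<and> (\<forall>x\<in>convex hull V. F x = g x))}"

definition piecewise_linear :: "'a::euclidean_space set set \<Rightarrow> ('a \<Rightarrow> real) \<Rightarrow> bool" where
  "piecewise_linear K F \<longleftrightarrow> (\<forall>V\<in>K. \<exists>a b. \<forall>x\<in>convex hull V. F x = a \<bullet> x + b)"

definition is_tent :: "'a::euclidean_space set set \<Rightarrow> 'a \<Rightarrow> ('a \<Rightarrow> real) \<Rightarrow> bool" where
  "is_tent K w T \<longleftrightarrow> T \<in> C0 K \<and> piecewise_linear K T \<and> T w = 1 \<and>
                     (\<forall>u\<in>complex_vertices K - {w}. T u = 0)"

(* Existence and uniqueness for vertices w of a complex: lemma ex1_tent below. *)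
definition tent :: "'a::euclidean_space set set \<Rightarrow> 'a \<Rightarrow> 'a \<Rightarrow> real" where
  "tent K w = (THE T. is_tent K w T)"

definition sums_of_squares :: "'a::euclidean_space set set \<Rightarrow> ('a \<Rightarrow> real) set" where
  "sums_of_squares K =
     {S. \<exists>(N::nat) h. (\<forall>j<N. h j \<in> C0 K) \<and> S = (\<lambda>x\<in>realization K. \<Sum>j<N. (h j x)\<^sup>2)}"


lemma affine_interpolation:
  fixes V :: "'a::euclidean_space set"
  assumes "\<not> affine_dependent V"
  shows "\<exists>a b. \<forall>u\<in>V. a \<bullet> u + b = f u"
proof (cases "V = {}")
  case False
  then obtain p where p: "p \<in> V" by blast
  let ?B = "(\<lambda>x. - p + x) ` (V - {p})"
  have "independent ?B"
    using assms p affine_dependent_iff_dependent2 by blast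
  then obtain g :: "'a \<Rightarrow> real" where g: "linear g" "\<forall>y\<in>?B. g y = f (p + y) - f p"
    using linear_independent_extend[of ?B "\<lambda>y. f (p + y) - f p"] by blast
  have gi: "g x = adjoint g 1 \<bullet> x" for x
    using adjoint_works[OF g(1), of x 1] by (simp add: inner_commute)
  have "adjoint g 1 \<bullet> u + (f p - g p) = f u" if "u \<in> V" for u
  proof (cases "u = p")
    case True
    then show ?thesis by (simp flip: gi)
  next
    case False
    with that have "- p + u \<in> ?B" by blast
    then have "g (- p + u) = f u - f p" using g(2) by fastforce
    moreover have "g (- p + u) = g u - g p"
      using linear_diff[OF g(1), of u p] by simp
    ultimately show ?thesis by (simp flip: gi)
  qed
  then show ?thesis by blast
qed auto

lemma affine_eq_on_convex_hull:
  fixes a a' :: "'a::euclidean_space"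
  assumes "\<And>u. u \<in> V \<Longrightarrow> a \<bullet> u + b = a' \<bullet> u + b'" and "x \<in> convex hull V"
  shows "a \<bullet> x + b = a' \<bullet> x + b'"
proof -
  have "convex hull V \<subseteq> {x. (a - a') \<bullet> x = b' - b}"
  proof (rule hull_minimal)
    show "V \<subseteq> {x. (a - a') \<bullet> x = b' - b}"
      using assms(1) by (force simp: inner_diff_left algebra_simps)
  qed (rule convex_hyperplane)
  then show ?thesis using assms(2) by (force simp: inner_diff_left algebra_simps)
qed

lemma independent_hull_eq:
  fixes V W :: "'a::euclidean_space set"
  assumes "\<not> affine_dependent V" "\<not> affine_dependent W" "convex hull V = convex hull W"
  shows "V = W"
  using extreme_point_of_convex_hull_affine_independent[OF assms(1)]
    extreme_point_of_convex_hull_affine_independent[OF assms(2)] assms(3) by auto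

lemma ex1_tent:
  fixes K :: "'a::euclidean_space set set"
  assumes K: "complex_of_simplices K" and w: "w \<in> complex_vertices K"
  shows "\<exists>!T. is_tent K w T"
proof -
  have ind: "\<not> affine_dependent V" "finite V" if "V \<in> K" for V
    using K that by (auto simp: complex_of_simplices_def simplex_vertices_def)
  have sub: "V \<subseteq> convex hull V" for V :: "'a set"
    by (simp add: hull_subset)
  obtain a b where ab: "\<And>V u. V \<in> K \<Longrightarrow> u \<in> V \<Longrightarrow> a V \<bullet> u + b V = (if u = w then 1 else 0::real)"
    using affine_interpolation[OF ind(1), where f = "\<lambda>u. if u = w then 1 else 0"] by metis
  have agree: "a V \<bullet> x + b V = a W \<bullet> x + b W"
    if VW: "V \<in> K" "W \<in> K" and x: "x \<in> convex hull V" "x \<in> convex hull W" for V W x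
  proof -
    obtain C D where C: "C \<subseteq> V" "convex hull V \<inter> convex hull W = convex hull C"
      and D: "D \<subseteq> W" "convex hull V \<inter> convex hull W = convex hull D"
      using K VW unfolding complex_of_simplices_def face_spanned_def by metis
    have "C = D"
    proof (rule independent_hull_eq)
      show "\<not> affine_dependent C"
        using affine_independent_subset[OF ind(1)[OF VW(1)] C(1)] .
      show "\<not> affine_dependent D"
        using affine_independent_subset[OF ind(1)[OF VW(2)] D(1)] .
      show "convex hull C = convex hull D" using C D by simp
    qed
    then have "C \<subseteq> W" using D(1) by simp
    have "a V \<bullet> u + b V = a W \<bullet> u + b W" if "u \<in> C" for u
      using ab[OF VW(1), of u] ab[OF VW(2), of u] that C(1) \<open>C \<subseteq> W\<close>
      by (metis subsetD)
    moreover have "x \<in> convex hull C" using C(2) x by blast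
    ultimately show ?thesis by (rule affine_eq_on_convex_hull)
  qed
  define c where "c x = (SOME V. V \<in> K \<and> x \<in> convex hull V)" for x
  define T where "T = (\<lambda>x\<in>realization K. a (c x) \<bullet> x + b (c x))"
  have T: "T x = a V \<bullet> x + b V" if "V \<in> K" "x \<in> convex hull V" for V x
  proof -
    have "c x \<in> K \<and> x \<in> convex hull (c x)"
      unfolding c_def by (rule someI[of _ V]) (use that in auto)
    then have "a (c x) \<bullet> x + b (c x) = a V \<bullet> x + b V"
      using agree that by blast
    moreover have "x \<in> realization K"
      using that unfolding realization_def by blast
    ultimately show ?thesis unfolding T_def by simp
  qed
  have Tv: "T u = (if u = w then 1 else 0)" if u: "u \<in> complex_vertices K" for u
  proof -
    obtain V where V: "V \<in> K" "u \<in> V" using u unfolding complex_vertices_def by blast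
    then have "u \<in> convex hull V" using sub by blast
    then show ?thesis using T[OF V(1)] ab[OF V] by metis
  qed
  have cont: "continuous_on (realization K) T"
    unfolding realization_def
  proof (rule continuous_on_closed_Union)
    show "finite K" using K by (simp add: complex_of_simplices_def)
    show "closed (convex hull V)" if "V \<in> K" for V
      using ind[OF that] by (simp add: compact_imp_closed finite_imp_compact_convex_hull)
    show "continuous_on (convex hull V) T" if "V \<in> K" for V
    proof -
      have "continuous_on (convex hull V) (\<lambda>x. a V \<bullet> x + b V)"
        by (intro continuous_intros)
      then show ?thesis by (rule continuous_on_eq) (simp only: T[OF that])
    qed
  qed
  have poly: "real_polynomial_function (\<lambda>x. a V \<bullet> x + b V)" for V
    by (intro real_polynomial_function.intros bounded_linear_inner_right)
  have "T \<in> extensional (realization K)" unfolding T_def by simp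
  moreover have "\<exists>g. real_polynomial_function g \<and> (\<forall>x\<in>convex hull V. T x = g x)" if "V \<in> K" for V
    using poly[of V] T[OF that] by blast
  ultimately have "T \<in> C0 K" using cont by (simp add: C0_def)
  moreover have "piecewise_linear K T" using T by (auto simp: piecewise_linear_def)
  ultimately have ex: "is_tent K w T" using Tv w by (simp add: is_tent_def)
  have "T' = T" if T': "is_tent K w T'" for T'
  proof
    fix x
    show "T' x = T x"
    proof (cases "x \<in> realization K")
      case True
      then obtain V where V: "V \<in> K" "x \<in> convex hull V" by (auto simp: realization_def)
      obtain a' b' where ab': "\<forall>x\<in>convex hull V. T' x = a' \<bullet> x + b'"
        using T' V(1) unfolding is_tent_def piecewise_linear_def by blast
      have "T' u = T u" if "u \<in> V" for u
      proof -
        have u: "u \<in> complex_vertices K" using that V by (auto simp: complex_vertices_def)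
        then show ?thesis using T' Tv[OF u] by (auto simp: is_tent_def)
      qed
      then have "a' \<bullet> u + b' = a V \<bullet> u + b V" if "u \<in> V" for u
        using that ab' T[OF V(1)] sub[of V] by (metis subsetD)
      then have "a' \<bullet> x + b' = a V \<bullet> x + b V"
        using V(2) by (rule affine_eq_on_convex_hull)
      then show ?thesis using ab' T V by simp
    next
      case False
      then show ?thesis using T' ex by (simp add: is_tent_def C0_def extensional_def)
    qed
  qed
  with ex show ?thesis by blast
qed

lemma is_tent_tent:
  assumes "complex_of_simplices K" and "w \<in> complex_vertices K"
  shows "is_tent K w (tent K w)"
  unfolding tent_def by (rule theI'[OF ex1_tent[OF assms]])

end

theory Submission
  imports Defs
begin

text \<open>The tent functions are the barycentric coordinates: they embed the complex into the standard
  simplex on its vertices, and every piecewise polynomial \<open>F\<close> is a form in them.  Adding a large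
  multiple of a nonnegative form whose zero set in the standard simplex is the complex makes the
  form of \<open>F - \<epsilon>\<close> strictly positive on the standard simplex.  By Polya's theorem \<open>F - \<epsilon>\<close> is then
  a combination, with nonnegative coefficients, of products of tent functions.  Such a product need
  not lie in the quadratic module generated by the tent functions, but it does after adding an
  arbitrarily small positive constant, and \<open>\<epsilon>\<close> pays for these constants.\<close>

section \<open>Quadratic modules of functions\<close>

text \<open>Why a small constant rescues a product: a quadratic module admits sums and
  multiplication by squares, not products of its members. The tent functions sum to 1, so one minus
  a tent function is the sum of the others, and both bounds 0 and 1 on every factor are certified
  inside the module. Certified bounds let a factor be written as a sum of squares plus an
  arbitrarily small remainder. The squares may multiply the rest of the product, and the remainder
  times the rest is absorbed by a constant. This step consists of algebraic identities only.

  The same relation makes homogeneity harmless: multiplying by the sum of the tent functions raises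
  the degree and keeps all values. Writing \<open>F\<close> as one form is a gluing problem, because
  the polynomials given on the simplices need to agree only on common faces.\<close>

locale quadratic_module =
  fixes D :: "'a set" and A M :: "('a \<Rightarrow> real) set"
  assumes A_const: "(\<lambda>x. c) \<in> A"
    and A_add: "\<lbrakk>f \<in> A; g \<in> A\<rbrakk> \<Longrightarrow> (\<lambda>x. f x + g x) \<in> A"
    and A_mult: "\<lbrakk>f \<in> A; g \<in> A\<rbrakk> \<Longrightarrow> (\<lambda>x. f x * g x) \<in> A"
    and M_subset: "M \<subseteq> A"
    and M_cong: "\<lbrakk>f \<in> M; \<And>x. x \<in> D \<Longrightarrow> g x = f x\<rbrakk> \<Longrightarrow> g \<in> M"
    and M_one: "(\<lambda>x. 1) \<in> M"
    and M_add: "\<lbrakk>f \<in> M; g \<in> M\<rbrakk> \<Longrightarrow> (\<lambda>x. f x + g x) \<in> M"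
    and M_square_mult: "\<lbrakk>h \<in> A; f \<in> M\<rbrakk> \<Longrightarrow> (\<lambda>x. (h x)\<^sup>2 * f x) \<in> M"
begin

lemma M_A: "f \<in> M \<Longrightarrow> f \<in> A"
  using M_subset by blast

lemma A_scale: "f \<in> A \<Longrightarrow> (\<lambda>x. c * f x) \<in> A"
  by (rule A_mult[OF A_const])

lemma M_scale:
  assumes "c \<ge> 0" "f \<in> M"
  shows "(\<lambda>x. c * f x) \<in> M"
  using M_square_mult[OF A_const[of "sqrt c"] assms(2)] assms(1) by simp

lemma M_const: "c \<ge> 0 \<Longrightarrow> (\<lambda>x. c) \<in> M"
  using M_scale[OF _ M_one] by simp

lemma M_square: "h \<in> A \<Longrightarrow> (\<lambda>x. (h x)\<^sup>2) \<in> M"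
  using M_square_mult[OF _ M_one] by simp

lemma M_sum:
  assumes "\<And>i. i \<in> I \<Longrightarrow> f i \<in> M"
  shows "(\<lambda>x. \<Sum>i\<in>I. f i x) \<in> M"
  using assms
proof (induction I rule: infinite_finite_induct)
  case (insert i I)
  then show ?case using M_add[of "f i" "\<lambda>x. \<Sum>i\<in>I. f i x"] by simp
qed (auto intro: M_const)

text \<open>The two factors add up to the constant \<open>c\<close>, so multiplying the product by
  \<open>f + (c - f)\<close> splits it into two members of \<open>M\<close>, each times a
  square.\<close>

lemma M_mult_complement:
  assumes c: "c > 0" and f: "f \<in> M" "(\<lambda>x. c - f x) \<in> M"
  shows "(\<lambda>x. f x * (c - f x)) \<in> M"
proof -
  have "(\<lambda>x. (1 / c) * ((c - f x)\<^sup>2 * f x + (f x)\<^sup>2 * (c - f x))) \<in> M"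
    using c by (intro M_scale M_add M_square_mult f M_A) auto
  then show ?thesis
    by (rule M_cong) (use c in \<open>simp add: field_simps power2_eq_square\<close>)
qed

lemma M_square_le:
  assumes c: "c > 0" and f: "f \<in> M" "(\<lambda>x. c - f x) \<in> M"
  shows "(\<lambda>x. c\<^sup>2 - (f x)\<^sup>2) \<in> M"
proof -
  have "(\<lambda>x. f x * (c - f x) + c * (c - f x)) \<in> M"
    using c by (intro M_add M_scale M_mult_complement f) auto
  then show ?thesis
    by (rule M_cong) (simp add: field_simps power2_eq_square)
qed

text \<open>Iterating \<open>x \<mapsto> x - x\<^sup>2\<close> splits squares off \<open>a\<close> and leaves a remainder that tends to 0,
  with certificates in \<^term>\<open>M\<close>.\<close>

lemma square_splitting:
  assumes a: "a \<in> M" "(\<lambda>x. 1 - a x) \<in> M"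
  shows "\<exists>r h. r \<in> M \<and> (\<lambda>x. 1 / real (Suc n) - r x) \<in> M \<and> (\<forall>k<n. h k \<in> A) \<and>
           (\<forall>x. a x = (\<Sum>k<n. (h k x)\<^sup>2) + r x)"
proof (induction n)
  case 0
  then show ?case using a by (intro exI[of _ a]) auto
next
  case (Suc n)
  then obtain r h where r: "r \<in> M" "(\<lambda>x. 1 / real (Suc n) - r x) \<in> M"
    and h: "\<forall>k<n. h k \<in> A" "\<forall>x. a x = (\<Sum>k<n. (h k x)\<^sup>2) + r x" by blast
  let ?c = "1 / real (Suc n)"
  have "(\<lambda>x. r x * (?c - r x) + (1 - ?c) * r x) \<in> M"
    by (intro M_add M_scale M_mult_complement r) (auto simp: field_simps)
  then have "(\<lambda>x. r x - (r x)\<^sup>2) \<in> M"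
    by (rule M_cong) (simp add: algebra_simps power2_eq_square)
  moreover have "(\<lambda>x. 1 / real (Suc (Suc n)) - (r x - (r x)\<^sup>2)) \<in> M"
  \<comment> \<open>The general case uses the tangent to \<open>x - x^2\<close> at
    \<open>?c\<close>, whose slope \<open>1 - 2 * ?c\<close> is negative for \<open>n = 0\<close>;
    there the maximum 1/4 of \<open>x - x^2\<close> suffices.\<close>
  proof (cases "n = 0")
    case True
    have "(\<lambda>x. (r x + - 1 / 2)\<^sup>2 + 1 / 4) \<in> M"
      by (intro M_add M_square M_const A_add A_const M_A r) auto
    then show ?thesis
      by (rule M_cong) (simp add: True field_simps power2_eq_square)
  next
    case False
    \<comment> \<open>\<open>e\<close> is the gap between the new bound and the value of
      \<open>x - x^2\<close> at the old bound \<open>?c\<close>. The square in the certificate is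
      the distance of the parabola from its tangent.\<close>
    define e where "e = 1 / real (Suc (Suc n)) - ?c + ?c\<^sup>2"
    have "e = 1 / ((real (Suc n))\<^sup>2 * real (Suc (Suc n)))"
      unfolding e_def by (simp add: divide_simps) (simp add: algebra_simps power2_eq_square)
    then have "e \<ge> 0" by simp
    moreover have "1 - 2 * ?c \<ge> 0" using False by (simp add: field_simps)
    ultimately have "(\<lambda>x. ((r x + - ?c)\<^sup>2 + (1 - 2 * ?c) * (?c - r x)) + e) \<in> M"
      by (intro M_add M_square M_scale M_const A_add A_const M_A r)
    then show ?thesis
      by (rule M_cong) (simp add: e_def algebra_simps power2_eq_square)
  qed
  moreover have "\<forall>k<Suc n. (if k = n then r else h k) \<in> A"
    using h(1) M_A[OF r(1)] by (auto simp: less_Suc_eq)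
  moreover have "\<forall>x. a x = (\<Sum>k<Suc n. ((if k = n then r else h k) x)\<^sup>2) + (r x - (r x)\<^sup>2)"
    using h(2) by simp
  ultimately show ?case
    by (intro exI[of _ "\<lambda>x. r x - (r x)\<^sup>2"] exI[of _ "\<lambda>k. if k = n then r else h k"]) blast
qed

text \<open>\<open>b\<close> need not lie in \<open>M\<close>, only \<open>b\<close> plus every
  positive constant; this is what lets the lemma be iterated. Only \<open>a\<close> is split into
  squares.\<close>

lemma mult_plus_const_in_M:
  assumes a: "a \<in> M" "(\<lambda>x. 1 - a x) \<in> M"
    and b: "b \<in> A" "\<And>\<delta>. \<delta> > 0 \<Longrightarrow> (\<lambda>x. b x + \<delta>) \<in> M" "(\<lambda>x. 1 - (b x)\<^sup>2) \<in> M"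
    and \<delta>: "\<delta> > 0"
  shows "(\<lambda>x. a x * b x + \<delta>) \<in> M"
proof -
  obtain n where n: "1 / real (Suc n) < \<delta> / 2"
    using \<delta> nat_approx_posE[of "\<delta> / 2"] by auto
  obtain r h where r: "r \<in> M" "(\<lambda>x. 1 / real (Suc n) - r x) \<in> M"
    and h: "\<forall>k<n. h k \<in> A" "\<forall>x. a x = (\<Sum>k<n. (h k x)\<^sup>2) + r x"
    using square_splitting[OF a] by blast
  define \<epsilon> where "\<epsilon> = 1 / real (Suc n)"
  have \<epsilon>: "\<epsilon> > 0" "\<epsilon> < \<delta> / 2" using n by (auto simp: \<epsilon>_def)
  have rb: "(\<lambda>x. r x * b x + \<epsilon>) \<in> M"
  proof -
    \<comment> \<open>Completing the square: \<open>r * b\<close> is the cross term, and the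
      certified bounds on \<open>r^2\<close> and \<open>b^2\<close> cancel the two pure
      squares.\<close>
    have "(\<lambda>x. (\<epsilon> / 2) * ((1 / \<epsilon>) * r x + b x)\<^sup>2 + (1 / (2 * \<epsilon>)) * (\<epsilon>\<^sup>2 - (r x)\<^sup>2)
             + (\<epsilon> / 2) * (1 - (b x)\<^sup>2)) \<in> M"
      using \<epsilon> r(2)
      by (intro M_add M_scale M_square M_square_le A_add A_scale M_A r b)
        (auto simp: \<epsilon>_def)
    then show ?thesis
      by (rule M_cong) (use \<epsilon> in \<open>simp add: field_simps power2_eq_square\<close>)
  qed
  \<comment> \<open>Shifting \<open>b\<close> by \<open>\<delta> / 2\<close> contributes
    \<open>(\<delta> / 2) * (a - r)\<close>, which the third group completes to
    \<open>\<delta> / 2\<close>. The other half of \<open>\<delta>\<close> pays for the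
    remainder.\<close>
  have "(\<lambda>x. (\<Sum>k<n. (h k x)\<^sup>2 * (b x + \<delta> / 2)) + (r x * b x + \<epsilon>)
           + ((\<delta> / 2) * (1 - a x) + (\<delta> / 2) * r x) + (\<delta> / 2 - \<epsilon>)) \<in> M"
    using \<epsilon> \<delta> h(1)
    by (intro M_add M_sum M_scale M_square_mult M_const rb r a b) auto
  then show ?thesis
  proof (rule M_cong)
    fix x
    have "(\<Sum>k<n. (h k x)\<^sup>2 * (b x + \<delta> / 2)) = (a x - r x) * (b x + \<delta> / 2)"
      using h(2) by (simp add: sum_distrib_right)
    then show "a x * b x + \<delta> = (\<Sum>k<n. (h k x)\<^sup>2 * (b x + \<delta> / 2)) + (r x * b x + \<epsilon>)
           + ((\<delta> / 2) * (1 - a x) + (\<delta> / 2) * r x) + (\<delta> / 2 - \<epsilon>)"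
      by (simp add: field_simps)
  qed
qed

text \<open>The three claims are the hypotheses on \<open>b\<close> in
  \<open>mult_plus_const_in_M\<close>, so the induction has to carry them together.\<close>

lemma prod_plus_const_in_M:
  assumes "finite J" and "\<And>j. j \<in> J \<Longrightarrow> a j \<in> M" "\<And>j. j \<in> J \<Longrightarrow> (\<lambda>x. 1 - a j x) \<in> M"
  shows "(\<lambda>x. \<Prod>j\<in>J. a j x) \<in> A \<and> (\<forall>\<delta>>0. (\<lambda>x. (\<Prod>j\<in>J. a j x) + \<delta>) \<in> M) \<and>
         (\<lambda>x. 1 - (\<Prod>j\<in>J. a j x)\<^sup>2) \<in> M"
  using assms
proof (induction J)
  case empty
  then show ?case by (auto intro: A_const M_const)
next
  case (insert i J)
  let ?b = "\<lambda>x. \<Prod>j\<in>J. a j x"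
  have b: "?b \<in> A" "\<And>\<delta>. \<delta> > 0 \<Longrightarrow> (\<lambda>x. ?b x + \<delta>) \<in> M" "(\<lambda>x. 1 - (?b x)\<^sup>2) \<in> M"
    using insert by auto
  have a: "a i \<in> M" "(\<lambda>x. 1 - a i x) \<in> M" using insert by auto
  have "(\<lambda>x. 1 - (a i x)\<^sup>2) \<in> M" using M_square_le[of 1] a by simp
  then have "(\<lambda>x. (1 - (?b x)\<^sup>2) + (?b x)\<^sup>2 * (1 - (a i x)\<^sup>2)) \<in> M"
    by (intro M_add M_square_mult b)
  then have "(\<lambda>x. 1 - (a i x * ?b x)\<^sup>2) \<in> M"
    by (rule M_cong) (simp add: algebra_simps power_mult_distrib)
  then show ?case
    using mult_plus_const_in_M[OF a b] A_mult[OF M_A[OF a(1)] b(1)] insert.hyps by simp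
qed

end

section \<open>Forms and Polya's theorem\<close>

text \<open>Forms are kept as functions, so evaluation is application and properties follow by
  induction. Over an empty \<open>I\<close> no form has positive degree, hence the later conditions
  that a variable exists.\<close>

inductive form :: "'i set \<Rightarrow> nat \<Rightarrow> (('i \<Rightarrow> real) \<Rightarrow> real) \<Rightarrow> bool" for I where
  form_const: "form I 0 (\<lambda>t. c)"
| form_var: "\<lbrakk>i \<in> I; form I d p\<rbrakk> \<Longrightarrow> form I (Suc d) (\<lambda>t. t i * p t)"
| form_add: "\<lbrakk>form I d p; form I d q\<rbrakk> \<Longrightarrow> form I d (\<lambda>t. p t + q t)"

lemma form_scale: "form I d p \<Longrightarrow> form I d (\<lambda>t. c * p t)"
proof (induction rule: form.induct)
  case (form_const c')
  show ?case by (rule form.form_const)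
next
  case (form_var i d p)
  then show ?case using form.form_var[of i I d "\<lambda>t. c * p t"] by (simp add: algebra_simps)
next
  case (form_add d p q)
  then show ?case using form.form_add[of I d "\<lambda>t. c * p t" "\<lambda>t. c * q t"]
    by (simp add: algebra_simps)
qed

lemma form_diff:
  assumes "form I d p" "form I d q"
  shows "form I d (\<lambda>t. p t - q t)"
  using form_add[OF assms(1) form_scale[OF assms(2), of "-1"]] by simp

lemma form_mult:
  assumes "form I d p" "form I e q"
  shows "form I (d + e) (\<lambda>t. p t * q t)"
  using assms(1)
proof (induction rule: form.induct)
  case (form_const c)
  then show ?case using form_scale[OF assms(2)] by simp
next
  case (form_var i d p)
  then show ?case using form.form_var[of i I "d + e" "\<lambda>t. p t * q t"] by (simp add: algebra_simps)
next
  case (form_add d p q')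
  then show ?case using form.form_add[of I "d + e" "\<lambda>t. p t * q t" "\<lambda>t. q' t * q t"]
    by (simp add: algebra_simps)
qed

lemma form_zero:
  assumes "i \<in> I"
  shows "form I d (\<lambda>t. 0)"
proof (induction d)
  case (Suc d)
  then show ?case using form_var[OF assms Suc] by simp
qed (rule form_const)

lemma form_linear:
  assumes "finite J" "J \<subseteq> I" "i \<in> I"
  shows "form I 1 (\<lambda>t. \<Sum>j\<in>J. c j * t j)"
  using assms(1,2)
proof (induction J)
  case empty
  show ?case using form_zero[OF \<open>i \<in> I\<close>] by simp
next
  case (insert j J)
  have "form I 1 (\<lambda>t. t j * c j)"
    using form_var[of j I 0, OF _ form_const] insert.prems by simp
  then show ?case
    using form_add[of I 1 "\<lambda>t. t j * c j" "\<lambda>t. \<Sum>j\<in>J. c j * t j"] insert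
    by (simp add: mult.commute)
qed

lemma form_power:
  assumes "form I d p"
  shows "form I (k * d) (\<lambda>t. p t ^ k)"
proof (induction k)
  case (Suc k)
  then show ?case using form_mult[OF assms Suc] by simp
qed (simp add: form_const)

lemma form_prod:
  assumes "finite J" "\<And>j. j \<in> J \<Longrightarrow> form I d (p j)"
  shows "form I (card J * d) (\<lambda>t. \<Prod>j\<in>J. p j t)"
  using assms
proof (induction J)
  case (insert j J)
  then show ?case using form_mult[of I d "p j" "card J * d" "\<lambda>t. \<Prod>j\<in>J. p j t"] by simp
qed (simp add: form_const)

lemma form_restrict:
  assumes "form I d p" "i \<in> I"
  shows "form I d (\<lambda>t. p (\<lambda>i. if i \<in> W then t i else 0))"
  using assms(1)
proof (induction rule: form.induct)
  case (form_const c)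
  then show ?case by (rule form.form_const)
next
  case (form_var j d p)
  then show ?case using form.form_var[of j I d "\<lambda>t. p (\<lambda>i. if i \<in> W then t i else 0)"]
     form_zero[OF assms(2)] by (cases "j \<in> W") simp_all
next
  case (form_add d p q)
  then show ?case using form.form_add by blast
qed

lemma form_homogeneous:
  "form I d p \<Longrightarrow> p (\<lambda>i. c * t i) = c ^ d * p t"
  by (induction rule: form.induct) (auto simp: algebra_simps)

lemma form_continuous:
  "form I d p \<Longrightarrow> continuous_on UNIV p"
  by (induction rule: form.induct) (auto intro!: continuous_intros continuous_on_product_coordinates)

section \<open>Forms as sums over words, and Polya's theorem\<close>

lemma sum_append:
  fixes f g :: "nat \<Rightarrow> 'a::comm_monoid_add"
  shows "(\<Sum>k<N + N'. if k < N then f k else g (k - N)) = (\<Sum>k<N. f k) + (\<Sum>k<N'. g k)"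
  by (induction N') (simp_all add: add.assoc)

text \<open>Monomials are words rather than exponent vectors because sampling refers to the
  positions of letters. Several \<open>k\<close> may carry the same monomial.\<close>

lemma form_monomials:
  assumes "form I d p"
  shows "\<exists>N c w. (\<forall>k<N. \<forall>j<d. w k j \<in> I) \<and>
           (\<forall>t. p t = (\<Sum>k<N::nat. c k * (\<Prod>j<d. t (w k (j::nat)))))"
  using assms
proof (induction rule: form.induct)
  case (form_const c)
  show ?case by (rule exI[of _ 1], rule exI[of _ "\<lambda>_. c"]) simp
next
  case (form_var i d p)
  then obtain N c w where w: "\<forall>k<N. \<forall>j<d. w k j \<in> I"
    and p: "\<forall>t. p t = (\<Sum>k<N::nat. c k * (\<Prod>j<d. t (w k (j::nat))))" by blast
  show ?case
    by (rule exI[of _ N], rule exI[of _ c], rule exI[of _ "\<lambda>k j. if j = d then i else w k j"])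
      (use w form_var.hyps in \<open>auto simp: p less_Suc_eq sum_distrib_left algebra_simps\<close>)
next
  case (form_add d p q)
  obtain N c w where w: "\<forall>k<N. \<forall>j<d. w k j \<in> I"
    and p: "\<forall>t. p t = (\<Sum>k<N::nat. c k * (\<Prod>j<d. t (w k (j::nat))))"
    using form_add.IH(1) by blast
  obtain N' c' w' where w': "\<forall>k<N'. \<forall>j<d. w' k j \<in> I"
    and q: "\<forall>t. q t = (\<Sum>k<N'::nat. c' k * (\<Prod>j<d. t (w' k (j::nat))))"
    using form_add.IH(2) by blast
  show ?case
  proof (intro exI conjI allI impI)
    show "(if k < N then w k else w' (k - N)) j \<in> I" if "k < N + N'" "j < d" for k j
      using w w' that by auto
    show "p t + q t = (\<Sum>k<N + N'. (if k < N then c k else c' (k - N)) *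
            (\<Prod>j<d. t ((if k < N then w k else w' (k - N)) j)))" for t
    proof -
      have "(\<Sum>k<N + N'. (if k < N then c k else c' (k - N)) *
            (\<Prod>j<d. t ((if k < N then w k else w' (k - N)) j))) =
          (\<Sum>k<N + N'. if k < N then c k * (\<Prod>j<d. t (w k j))
             else c' (k - N) * (\<Prod>j<d. t (w' (k - N) j)))"
        by (intro sum.cong refl) simp
      then show ?thesis by (simp add: p q
          sum_append[where f = "\<lambda>k. c k * (\<Prod>j<d. t (w k j))"
            and g = "\<lambda>k. c' k * (\<Prod>j<d. t (w' k j))"])
    qed
  qed
qed

text \<open>Read \<open>t\<close> as a distribution of independent letters: the positions hit by
  \<open>\<iota>\<close> contribute the prescribed letter, and every free position contributes the
  total mass 1.\<close>

lemma monomial_eq_sum_words: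
  fixes t :: "'i \<Rightarrow> real"
  assumes "finite I" and t: "sum t I = 1" and w: "\<And>j. j < d \<Longrightarrow> w j \<in> I"
    and \<iota>: "inj_on \<iota> {..<d}" "\<iota> ` {..<d} \<subseteq> {..<n::nat}"
  shows "(\<Sum>s \<in> {s \<in> {..<n} \<rightarrow>\<^sub>E I. \<forall>j<d. s (\<iota> j) = w j}. \<Prod>l<n. t (s l)) = (\<Prod>j<d. t (w j))"
proof -
  define B where "B l = {y \<in> I. \<forall>j<d. \<iota> j = l \<longrightarrow> y = w j}" for l
  have fin: "finite (B l)" for l using \<open>finite I\<close> by (simp add: B_def)
  have "{s \<in> {..<n} \<rightarrow>\<^sub>E I. \<forall>j<d. s (\<iota> j) = w j} = PiE {..<n} B"
  proof (rule set_eqI)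
    fix s
    have "(\<forall>j<d. s (\<iota> j) = w j) \<longleftrightarrow> (\<forall>l<n. \<forall>j<d. \<iota> j = l \<longrightarrow> s l = w j)"
      using \<iota>(2) by blast
    then show "s \<in> {s \<in> {..<n} \<rightarrow>\<^sub>E I. \<forall>j<d. s (\<iota> j) = w j} \<longleftrightarrow> s \<in> PiE {..<n} B"
      unfolding B_def PiE_iff by blast
  qed
  then have "(\<Sum>s \<in> {s \<in> {..<n} \<rightarrow>\<^sub>E I. \<forall>j<d. s (\<iota> j) = w j}. \<Prod>l<n. t (s l))
      = (\<Prod>l<n. \<Sum>y\<in>B l. t y)"
    using prod_sum_PiE[of "{..<n}" B "\<lambda>_. t"] fin by simp
  also have "\<dots> = (\<Prod>l\<in>\<iota> ` {..<d}. \<Sum>y\<in>B l. t y)"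
  proof (rule prod.mono_neutral_right)
    show "\<forall>l\<in>{..<n} - \<iota> ` {..<d}. (\<Sum>y\<in>B l. t y) = 1"
    proof
      fix l assume "l \<in> {..<n} - \<iota> ` {..<d}"
      then have "B l = I" by (auto simp: B_def)
      then show "(\<Sum>y\<in>B l. t y) = 1" using t by simp
    qed
  qed (use \<iota> in auto)
  also have "\<dots> = (\<Prod>j<d. \<Sum>y\<in>B (\<iota> j). t y)"
    using \<iota>(1) by (simp add: prod.reindex)
  also have "\<dots> = (\<Prod>j<d. t (w j))"
  proof (rule prod.cong)
    fix j assume j: "j \<in> {..<d}"
    then have "B (\<iota> j) = {w j}"
      using w inj_onD[OF \<iota>(1)] by (auto simp: B_def)
    then show "(\<Sum>y\<in>B (\<iota> j). t y) = t (w j)" by simp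
  qed simp
  finally show ?thesis .
qed

definition std_simplex :: "'i set \<Rightarrow> ('i \<Rightarrow> real) set" where
  "std_simplex I = {t. (\<forall>i. t i \<ge> 0) \<and> (\<forall>i. i \<notin> I \<longrightarrow> t i = 0) \<and> sum t I = 1}"

text \<open>A falling factorial over a power is a product of \<open>d\<close> factors tending to 1.
  The quotient is the chance that \<open>d\<close> draws with replacement hit distinct
  positions.\<close>

lemma card_injections_tendsto:
  "(\<lambda>n. real (card {\<iota> \<in> {..<d} \<rightarrow>\<^sub>E {..<n}. inj_on \<iota> {..<d}}) / real (n ^ d)) \<longlonglongrightarrow> 1"
proof -
  have "(\<lambda>n. \<Prod>i<d. 1 - real i / real n) \<longlonglongrightarrow> (\<Prod>i<d. 1 - 0)"
    by (intro tendsto_prod tendsto_diff tendsto_const lim_const_over_n)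
  moreover have "\<forall>\<^sub>F n in sequentially. (\<Prod>i<d. 1 - real i / real n) =
     real (card {\<iota> \<in> {..<d} \<rightarrow>\<^sub>E {..<n}. inj_on \<iota> {..<d}}) / real (n ^ d)"
    using eventually_ge_at_top[of "Suc d"]
  proof eventually_elim
    case (elim n)
    have "card {\<iota> \<in> {..<d} \<rightarrow>\<^sub>E {..<n}. inj_on \<iota> {..<d}} = (\<Prod>i<d. n - i)"
      using card_inj_on_subset_funcset[of "{..<d}" "{..<n}" "{..<d}"]
      by (simp add: lessThan_atLeast0)
    then have "real (card {\<iota> \<in> {..<d} \<rightarrow>\<^sub>E {..<n}. inj_on \<iota> {..<d}}) / real (n ^ d) =
        (\<Prod>i<d. real (n - i)) / (\<Prod>i<d. real n)" by simp
    also have "\<dots> = (\<Prod>i<d. real (n - i) / real n)" by (rule prod_dividef[symmetric])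
    also have "\<dots> = (\<Prod>i<d. 1 - real i / real n)"
      using elim by (intro prod.cong) (auto simp: diff_divide_distrib)
    finally show ?case by simp
  qed
  ultimately show ?thesis by (simp add: tendsto_cong)
qed

text \<open>Polya's theorem by sampling: the coefficient of the word \<open>s\<close> averages the multilinear form of
  \<open>p\<close> over all ways to draw \<open>d\<close> of the \<open>n\<close> letters of \<open>s\<close> without replacement.  Drawing with
  replacement would give the value of \<open>p\<close> at the letter frequencies of \<open>s\<close>, and for large \<open>n\<close>
  the two differ arbitrarily little.\<close>

lemma polya:
  assumes fin: "finite I" and p: "form I d p" and \<mu>: "\<mu> > 0"
    and pos: "\<And>t. t \<in> std_simplex I \<Longrightarrow> p t \<ge> \<mu>"
  shows "\<exists>n c. (\<forall>s\<in>{..<n::nat} \<rightarrow>\<^sub>E I. c s \<ge> 0) \<and>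
           (\<forall>t\<in>std_simplex I. p t = (\<Sum>s\<in>{..<n} \<rightarrow>\<^sub>E I. c s * (\<Prod>l<n. t (s l))))"
proof -
  obtain N c w where w: "\<And>k j. k < N \<Longrightarrow> j < d \<Longrightarrow> w k j \<in> I"
    and p: "\<And>t. p t = (\<Sum>k<N::nat. c k * (\<Prod>j<d. t (w k (j::nat))))"
    using form_monomials[OF p] by blast
  define B where "B = (\<Sum>k<N. \<bar>c k\<bar>)"
  have B: "B \<ge> 0" by (simp add: B_def sum_nonneg)
  define J where "J n = {\<iota> \<in> {..<d} \<rightarrow>\<^sub>E {..<n::nat}. inj_on \<iota> {..<d}}" for n
  define r where "r n = real (card (J n)) / real (n ^ d)" for n
  have "r \<longlonglongrightarrow> 1"
    using card_injections_tendsto[of d] by (simp add: r_def [abs_def] J_def)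
  then have lim: "(\<lambda>n. B * (1 - r n)) \<longlonglongrightarrow> B * (1 - 1)"
    by (intro tendsto_mult tendsto_diff tendsto_const)
  \<comment> \<open>\<open>B * (1 - r n)\<close> bounds the discrepancy between the two ways of
    drawing, relative to \<open>n ^ d\<close>. Positivity of \<open>r n\<close> provides an
    injection, so that averages over \<open>J n\<close> make sense.\<close>
  have "\<forall>\<^sub>F n in sequentially. r n > 0 \<and> B * (1 - r n) < \<mu> \<and> n > 0"
    using \<mu> by (intro eventually_conj order_tendstoD(1)[OF \<open>r \<longlonglongrightarrow> 1\<close>]
        order_tendstoD(2)[OF lim] eventually_gt_at_top) auto
  then obtain n where n: "r n > 0" "B * (1 - r n) < \<mu>" "n > 0"
    using eventually_happens'[OF sequentially_bot] by fast
  let ?E = "{..<d} \<rightarrow>\<^sub>E {..<n}" and ?W = "{..<n} \<rightarrow>\<^sub>E I"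
  have finE: "finite ?E" "finite (J n)" and JE: "J n \<subseteq> ?E" and finW: "finite ?W"
    using fin by (auto simp: J_def intro!: finite_PiE)
  have cardE: "card ?E = n ^ d" by (simp add: card_funcsetE)
  have cardJ: "card (J n) > 0" using n(1) by (simp add: r_def zero_less_divide_iff)
  \<comment> \<open>\<open>M k s\<close> holds all draws of positions from \<open>s\<close> that
    spell the \<open>k\<close>-th word; intersecting with \<open>J n\<close> keeps the draws without
    replacement.\<close>
  define M where "M k s = {\<iota> \<in> ?E. \<forall>j<d. s (\<iota> j) = w k j}" for k s
  define c' where "c' s = (\<Sum>k<N. c k * real (card (M k s \<inter> J n))) / real (card (J n))" for s
  have "c' s \<ge> 0" if s: "s \<in> ?W" for s
  proof -
    define t where "t i = real (card {l \<in> {..<n}. s l = i}) / real n" for i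
    have "t \<in> std_simplex I"
    proof -
      have "t i = 0" if "i \<notin> I" for i
      proof -
        have "{l \<in> {..<n}. s l = i} = {}" using s that by auto
        then show ?thesis unfolding t_def by simp
      qed
      moreover have "(\<Sum>i\<in>I. card {l \<in> {..<n}. s l = i}) = card {..<n}"
        using sum.group[of "{..<n}" I s "\<lambda>_. 1::nat"] s fin by (auto simp: PiE_iff)
      then have "sum t I = 1"
        using n(3) unfolding t_def by (simp flip: sum_divide_distrib of_nat_sum)
      moreover have "t i \<ge> 0" for i by (simp add: t_def)
      ultimately show ?thesis by (simp add: std_simplex_def)
    qed
    then have "real (n ^ d) * \<mu> \<le> real (n ^ d) * p t"
      by (rule mult_left_mono[OF pos]) simp
    moreover have "real (n ^ d) * p t = (\<Sum>k<N. c k * real (card (M k s)))"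
    proof -
      have mon: "real (n ^ d) * (\<Prod>j<d. t (w k j)) = real (card (M k s))" for k
      proof -
        have "M k s = PiE {..<d} (\<lambda>j. {l \<in> {..<n}. s l = w k j})"
          unfolding M_def by (rule set_eqI) (simp add: PiE_iff, blast)
        then have "card (M k s) = (\<Prod>j<d. card {l \<in> {..<n}. s l = w k j})"
          by (simp only: card_PiE finite_lessThan)
        also have "real \<dots> = (\<Prod>j<d. real n * t (w k j))"
          using n(3) by (simp add: t_def)
        also have "\<dots> = real (n ^ d) * (\<Prod>j<d. t (w k j))"
          by (simp add: prod.distrib)
        finally show ?thesis by (rule sym)
      qed
      have "real (n ^ d) * (c k * (\<Prod>j<d. t (w k j))) = c k * real (card (M k s))" for k
        unfolding mon[symmetric] by (rule mult.left_commute)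
      then show ?thesis by (simp only: p sum_distrib_left)
    qed
    ultimately have "real (n ^ d) * \<mu> \<le> (\<Sum>k<N. c k * real (card (M k s)))" by simp
    also have "\<dots> \<le> (\<Sum>k<N. c k * real (card (M k s \<inter> J n)) + \<bar>c k\<bar> * (real (n ^ d) - real (card (J n))))"
    \<comment> \<open>The draws lost are not injective, so there are at most
      \<open>n ^ d - card (J n)\<close> of them; the coefficients may have either sign, hence the
      absolute value.\<close>
    proof (rule sum_mono)
      fix k
      have M: "M k s \<subseteq> ?E" by (auto simp: M_def)
      then have "finite (M k s)" using finE finite_subset by blast
      then have "card (M k s) = card (M k s \<inter> J n) + card (M k s - J n)"
        using card_Int_Diff by blast
      moreover have "card (M k s - J n) \<le> card (?E - J n)"
        using M finE by (intro card_mono) auto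
      moreover have "card (?E - J n) = n ^ d - card (J n)"
        using card_Diff_subset[OF finE(2) JE] cardE by simp
      moreover have "card (J n) \<le> n ^ d" using card_mono[OF finE(1) JE] cardE by simp
      ultimately have "real (card (M k s)) - real (card (M k s \<inter> J n)) \<le> real (n ^ d) - real (card (J n))"
        "real (card (M k s)) - real (card (M k s \<inter> J n)) \<ge> 0"
        by linarith+
      then have "\<bar>c k\<bar> * (real (card (M k s)) - real (card (M k s \<inter> J n)))
         \<le> \<bar>c k\<bar> * (real (n ^ d) - real (card (J n)))"
        and "c k * (real (card (M k s)) - real (card (M k s \<inter> J n)))
         \<le> \<bar>c k\<bar> * (real (card (M k s)) - real (card (M k s \<inter> J n)))"
        by (auto intro: mult_left_mono mult_right_mono)
      then show "c k * real (card (M k s)) \<le> c k * real (card (M k s \<inter> J n))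
           + \<bar>c k\<bar> * (real (n ^ d) - real (card (J n)))"
        by (simp add: algebra_simps)
    qed
    also have "\<dots> = (\<Sum>k<N. c k * real (card (M k s \<inter> J n))) + real (n ^ d) * (B * (1 - r n))"
    proof -
      have X: "real (n ^ d) - real (card (J n)) = real (n ^ d) * (1 - r n)"
        using n(3) by (simp add: r_def right_diff_distrib)
      show ?thesis
        unfolding X sum.distrib B_def sum_distrib_right[symmetric] by simp
    qed
    also have "\<dots> \<le> (\<Sum>k<N. c k * real (card (M k s \<inter> J n))) + real (n ^ d) * \<mu>"
      using n(2) by (intro add_left_mono mult_left_mono) auto
    finally show ?thesis unfolding c'_def by simp
  qed
  moreover have "p t = (\<Sum>s\<in>?W. c' s * (\<Prod>l<n. t (s l)))" if "t \<in> std_simplex I" for t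
  proof -
    have t: "sum t I = 1" using that by (simp add: std_simplex_def)
    \<comment> \<open>The expansion into words is summed over all injections; exchanging the sums
      counts, for each \<open>s\<close>, the injections that spell the monomial.\<close>
    have mon: "real (card (J n)) * (\<Prod>j<d. t (w k j)) =
        (\<Sum>s\<in>?W. real (card (M k s \<inter> J n)) * (\<Prod>l<n. t (s l)))" if k: "k < N" for k
    proof -
      have "real (card (J n)) * (\<Prod>j<d. t (w k j)) = (\<Sum>\<iota>\<in>J n. \<Prod>j<d. t (w k j))" by simp
      also have "\<dots> = (\<Sum>\<iota>\<in>J n. \<Sum>s\<in>{s \<in> ?W. \<forall>j<d. s (\<iota> j) = w k j}. \<Prod>l<n. t (s l))"
        by (intro sum.cong refl monomial_eq_sum_words[symmetric] fin t w k) (auto simp: J_def)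
      also have "\<dots> = (\<Sum>s\<in>?W. \<Sum>\<iota>\<in>{\<iota> \<in> J n. \<forall>j<d. s (\<iota> j) = w k j}. \<Prod>l<n. t (s l))"
        by (rule sum.swap_restrict[OF finE(2) finW])
      also have "\<dots> = (\<Sum>s\<in>?W. real (card (M k s \<inter> J n)) * (\<Prod>l<n. t (s l)))"
      proof (rule sum.cong)
        fix s
        have "{\<iota> \<in> J n. \<forall>j<d. s (\<iota> j) = w k j} = M k s \<inter> J n"
          using JE by (auto simp: M_def)
        then show "(\<Sum>\<iota>\<in>{\<iota> \<in> J n. \<forall>j<d. s (\<iota> j) = w k j}. \<Prod>l<n. t (s l)) =
            real (card (M k s \<inter> J n)) * (\<Prod>l<n. t (s l))" by simp
      qed simp
      finally show ?thesis .
    qed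
    have "real (card (J n)) * p t = (\<Sum>k<N. c k * (real (card (J n)) * (\<Prod>j<d. t (w k j))))"
      by (simp add: p sum_distrib_left mult.left_commute)
    also have "\<dots> = (\<Sum>k<N. \<Sum>s\<in>?W. c k * real (card (M k s \<inter> J n)) * (\<Prod>l<n. t (s l)))"
      by (rule sum.cong) (simp_all add: mon sum_distrib_left mult.assoc)
    also have "\<dots> = (\<Sum>s\<in>?W. \<Sum>k<N. c k * real (card (M k s \<inter> J n)) * (\<Prod>l<n. t (s l)))"
      by (rule sum.swap)
    also have "\<dots> = real (card (J n)) * (\<Sum>s\<in>?W. c' s * (\<Prod>l<n. t (s l)))"
    proof -
      have cJ: "real (card (J n)) * c' s = (\<Sum>k<N. c k * real (card (M k s \<inter> J n)))" for s
        using cardJ by (simp add: c'_def)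
      show ?thesis
        by (simp only: sum_distrib_left mult.assoc[symmetric] cJ sum_distrib_right)
    qed
    finally show ?thesis using cardJ by simp
  qed
  ultimately show ?thesis by blast
qed

section \<open>The standard simplex, change of degree, and extension of forms\<close>

lemma compact_std_simplex:
  assumes "finite I"
  shows "compact (std_simplex I)"
proof -
  \<comment> \<open>Points are functions on the whole index type, so compactness comes from
    Tychonoff, with the factor \<open>{0}\<close> at every index outside \<open>I\<close>.\<close>
  have "std_simplex I = PiE UNIV (\<lambda>i. if i \<in> I then {0..1} else {0}) \<inter> {t. sum t I = 1}"
  proof -
    have le1: "t i \<le> 1" if "t \<in> std_simplex I" "i \<in> I" for t i
      using that member_le_sum[of i I t] assms by (auto simp: std_simplex_def)
    moreover have "t \<in> std_simplex I"
      if "\<forall>i. t i \<in> (if i \<in> I then {0..1} else {0})" "sum t I = 1" for t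
    proof -
      have "t i \<ge> 0 \<and> (i \<notin> I \<longrightarrow> t i = 0)" for i
        using that(1)[rule_format, of i] by (auto split: if_splits)
      then show ?thesis using that(2) by (simp add: std_simplex_def)
    qed
    moreover have "t i \<in> (if i \<in> I then {0..1} else {0})" "sum t I = 1"
      if "t \<in> std_simplex I" for t i
      using le1[OF that] that by (auto simp: std_simplex_def)
    ultimately show ?thesis unfolding PiE_UNIV_domain by blast
  qed
  moreover have "compact (PiE UNIV (\<lambda>i. if i \<in> I then {0..1} else {0::real}))"
    using compactin_PiE[of "\<lambda>_. euclidean" UNIV "\<lambda>i. if i \<in> I then {0..1} else {0::real}"]
    by (simp add: euclidean_product_topology)
  moreover have "closed {t. sum t I = (1::real)}"
    by (intro closed_Collect_eq continuous_intros continuous_on_product_coordinates)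
  ultimately show ?thesis by (simp add: compact_Int_closed)
qed

lemma form_sum: "finite I \<Longrightarrow> I \<noteq> {} \<Longrightarrow> form I 1 (\<lambda>t. sum t I)"
  using form_linear[of I I _ "\<lambda>_. 1"] by auto

text \<open>The factor is 1 on the standard simplex, so forms of different degrees can be brought to
  a common degree without changing their values there.\<close>

lemma form_pad:
  assumes "finite I" "I \<noteq> {}" "form I d p"
  shows "form I (d + e) (\<lambda>t. p t * sum t I ^ e)"
  using form_mult[OF assms(3) form_power[OF form_sum[OF assms(1,2)], of e]] by simp

text \<open>Restricting the variables to \<^term>\<open>W\<close> is a projection, and these projections commute; \<open>r\<close> is
  the image of \<open>h\<close> under the product of the complementary projections.\<close>

lemma form_vanishing_extension:
  assumes "finite \<W>" and h: "form I k h" and "i \<in> I"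
    and vanish: "\<forall>W\<in>\<W>. \<forall>t. (\<forall>w. 0 \<le> t w) \<longrightarrow> (\<forall>w. w \<notin> V \<inter> W \<longrightarrow> t w = 0) \<longrightarrow> h t = 0"
  shows "\<exists>r. form I k r \<and> (\<forall>t. (\<forall>w. 0 \<le> t w) \<longrightarrow> (\<forall>w. w \<notin> V \<longrightarrow> t w = 0) \<longrightarrow> r t = h t) \<and>
           (\<forall>W\<in>\<W>. \<forall>t. (\<forall>w. w \<notin> W \<longrightarrow> t w = 0) \<longrightarrow> r t = 0)"
  using assms(1) vanish
proof (induction \<W>)
  case empty
  then show ?case using h by blast
next
  case (insert U \<W>)
  have "\<forall>W\<in>\<W>. \<forall>t. (\<forall>w. 0 \<le> t w) \<longrightarrow> (\<forall>w. w \<notin> V \<inter> W \<longrightarrow> t w = 0) \<longrightarrow> h t = 0"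
    using insert.prems by simp
  from insert.IH[OF this] obtain r where r: "form I k r"
    and rh: "\<forall>t. (\<forall>w. 0 \<le> t w) \<longrightarrow> (\<forall>w. w \<notin> V \<longrightarrow> t w = 0) \<longrightarrow> r t = h t"
    and r0: "\<forall>W\<in>\<W>. \<forall>t. (\<forall>w. w \<notin> W \<longrightarrow> t w = 0) \<longrightarrow> r t = 0" by (elim exE conjE)
  define \<rho> where "\<rho> t = (\<lambda>i. if i \<in> U then t i else 0)" for t :: "'a \<Rightarrow> real"
  have "form I k (\<lambda>t. r t - r (\<rho> t))"
    unfolding \<rho>_def by (rule form_diff[OF r form_restrict[OF r \<open>i \<in> I\<close>]])
  moreover have "r t - r (\<rho> t) = h t" if t: "\<forall>w. 0 \<le> t w" "\<forall>w. w \<notin> V \<longrightarrow> t w = 0" for t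
  proof -
    \<comment> \<open>\<open>\<rho> t\<close> is supported in \<open>V \<inter> U\<close>, so the
      subtracted term is invisible on \<open>V\<close>.\<close>
    have "h (\<rho> t) = 0"
      using insert.prems t by (simp add: \<rho>_def)
    moreover have "r (\<rho> t) = h (\<rho> t)" "r t = h t"
      using t by (simp_all add: rh \<rho>_def)
    ultimately show ?thesis by simp
  qed
  moreover have "r t - r (\<rho> t) = 0"
    if W: "W \<in> insert U \<W>" and t: "\<forall>w. w \<notin> W \<longrightarrow> t w = 0" for W t
  proof (cases "W = U")
    case True
    then have "\<rho> t = t" using t by (auto simp: \<rho>_def)
    then show ?thesis by simp
  next
    case False
    then have "W \<in> \<W>" using W by simp
    \<comment> \<open>\<open>\<rho>\<close> only sets further coordinates to 0, so
      \<open>\<rho> t\<close> still vanishes off \<open>W\<close> and both terms are 0.\<close>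
    then show ?thesis using t by (simp add: r0 \<rho>_def)
  qed
  ultimately show ?case by blast
qed

section \<open>Piecewise polynomials on a simplicial complex\<close>

locale geometric_complex =
  fixes K :: "'a::euclidean_space set set"
  assumes complex: "complex_of_simplices K"
begin

abbreviation "I \<equiv> complex_vertices K"
abbreviation "D \<equiv> realization K"

text \<open>The value 0 off the vertices makes \<open>bary x\<close> a point of
  \<open>std_simplex I\<close> for \<open>x\<close> in \<open>D\<close>. No simplex is mentioned, so
  the coordinates found in different simplices containing \<open>x\<close> agree.\<close>

definition bary :: "'a \<Rightarrow> 'a \<Rightarrow> real" where
  "bary x w = (if w \<in> I then tent K w x else 0)"

lemma finite_K: "finite K"
  using complex by (simp add: complex_of_simplices_def)

lemma simplexD:
  assumes "V \<in> K"
  shows "finite V" "V \<noteq> {}" "V \<subseteq> I" "convex hull V \<subseteq> D"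
  using complex assms
  by (auto simp: complex_of_simplices_def simplex_vertices_def complex_vertices_def realization_def)

lemma finite_vertices: "finite I"
  using finite_K simplexD(1) by (auto simp: complex_vertices_def)

lemma bary_combination:
  assumes V: "V \<in> K" and u: "\<And>v. v \<in> V \<Longrightarrow> 0 \<le> u v" "sum u V = 1" "\<And>w. w \<notin> V \<Longrightarrow> u w = 0"
  shows "bary (\<Sum>v\<in>V. u v *\<^sub>R v) = u"
proof
  fix w
  let ?x = "\<Sum>v\<in>V. u v *\<^sub>R v"
  show "bary ?x w = u w"
  proof (cases "w \<in> I")
    case True
    have T: "is_tent K w (tent K w)" by (rule is_tent_tent[OF complex True])
    then obtain a b where ab: "\<And>y. y \<in> convex hull V \<Longrightarrow> tent K w y = a \<bullet> y + b"
      using V unfolding is_tent_def piecewise_linear_def by blast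
    have Tv: "tent K w v = (if v = w then 1 else 0)" if "v \<in> V" for v
      using T that simplexD(3)[OF V] by (auto simp: is_tent_def)
    have "?x \<in> convex hull V"
      using u(1,2) by (auto simp: convex_hull_finite[OF simplexD(1)[OF V]])
    \<comment> \<open>The weights add up to 1, so the constant \<open>b\<close> can be distributed
      over the vertices together with the linear part.\<close>
    then have "tent K w ?x = a \<bullet> ?x + b * sum u V" using ab u(2) by simp
    also have "\<dots> = (\<Sum>v\<in>V. u v * (a \<bullet> v + b))"
      by (simp add: inner_sum_right sum_distrib_left sum_distrib_right sum.distrib algebra_simps)
    also have "\<dots> = (\<Sum>v\<in>V. u v * tent K w v)"
      by (intro sum.cong refl) (simp add: ab hull_inc)
    also have "\<dots> = (\<Sum>v\<in>V. if v = w then u v else 0)"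
      by (intro sum.cong refl) (simp add: Tv)
    also have "\<dots> = u w"
      using u(3) simplexD(1)[OF V] by simp
    finally show ?thesis using True by (simp add: bary_def)
  next
    case False
    then show ?thesis using u(3) simplexD(3)[OF V] by (auto simp: bary_def)
  qed
qed

lemma bary_in_simplex:
  assumes V: "V \<in> K" and x: "x \<in> convex hull V"
  shows "bary x \<in> std_simplex I" "\<And>w. w \<notin> V \<Longrightarrow> bary x w = 0"
    "(\<Sum>w\<in>I. bary x w *\<^sub>R w) = x"
proof -
  obtain u where u: "\<forall>v\<in>V. 0 \<le> u v" "sum u V = 1" "(\<Sum>v\<in>V. u v *\<^sub>R v) = x"
    using x by (auto simp: convex_hull_finite[OF simplexD(1)[OF V]])
  define u' where "u' w = (if w \<in> V then u w else 0)" for w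
  have s: "(\<Sum>v\<in>V. u' v *\<^sub>R v) = x" "sum u' V = 1"
    using u by (simp_all add: u'_def)
  have b: "bary x = u'"
    using bary_combination[OF V, of u'] u s by (auto simp: u'_def)
  show "bary x w = 0" if "w \<notin> V" for w using that by (simp add: b u'_def)
  have sup: "sum u' I = sum u' V" "(\<Sum>v\<in>I. u' v *\<^sub>R v) = (\<Sum>v\<in>V. u' v *\<^sub>R v)"
    by (rule sum.mono_neutral_right[OF finite_vertices simplexD(3)[OF V]]; simp add: u'_def)+
  then show "(\<Sum>w\<in>I. bary x w *\<^sub>R w) = x" using b s by simp
  show "bary x \<in> std_simplex I"
    using b s sup u(1) simplexD(3)[OF V] by (auto simp: std_simplex_def u'_def)
qed

lemma bary_std_simplex:
  assumes "x \<in> D"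
  shows "bary x \<in> std_simplex I"
  using assms bary_in_simplex(1) by (auto simp: realization_def)

lemma sum_bary: "x \<in> D \<Longrightarrow> sum (bary x) I = 1"
  using bary_std_simplex by (simp add: std_simplex_def)

text \<open>The subset \<open>W\<close> allows common faces \<open>V \<inter> W'\<close> of two
  simplices, which need not themselves belong to \<open>K\<close>.\<close>

lemma bary_surj:
  assumes V: "V \<in> K" and t: "t \<in> std_simplex I" "\<And>w. w \<notin> W \<Longrightarrow> t w = 0" and W: "W \<subseteq> V"
  shows "\<exists>x \<in> convex hull W. bary x = t"
proof
  let ?x = "\<Sum>v\<in>W. t v *\<^sub>R v"
  have WI: "W \<subseteq> I" "finite W" using W simplexD[OF V] by (auto intro: finite_subset)
  have sums: "sum t I = sum t W"
    by (rule sum.mono_neutral_right[OF finite_vertices WI(1)]) (simp add: t(2))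
  moreover have "sum t V = sum t W" "(\<Sum>v\<in>V. t v *\<^sub>R v) = ?x"
    by (rule sum.mono_neutral_right[OF simplexD(1)[OF V] W]; simp add: t(2))+
  ultimately show "bary ?x = t"
    using bary_combination[OF V, of t] t W by (auto simp: std_simplex_def)
  show "?x \<in> convex hull W"
    using t sums by (auto simp: convex_hull_finite[OF WI(2)] std_simplex_def)
qed

section \<open>From piecewise polynomials to forms in the barycentric coordinates\<close>

lemma polynomial_form:
  assumes "real_polynomial_function g" and I: "I \<noteq> {}"
  shows "\<exists>d p. form I d p \<and> (\<forall>x\<in>D. g x = p (bary x))"
  using assms(1)
proof (induction rule: real_polynomial_function.induct)
  case (linear f)
  have "f x = (\<Sum>w\<in>I. f w * bary x w)" if x: "x \<in> D" for x
  proof -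
    interpret f: bounded_linear f by fact
    have "(\<Sum>w\<in>I. bary x w *\<^sub>R w) = x" using x bary_in_simplex(3) by (auto simp: realization_def)
    then have "f x = f (\<Sum>w\<in>I. bary x w *\<^sub>R w)" by simp
    then show ?thesis by (simp add: f.sum f.scaleR mult.commute)
  qed
  moreover obtain i where "i \<in> I" using I by blast
  ultimately show ?case
    using form_linear[OF finite_vertices order_refl \<open>i \<in> I\<close>, of f] by blast
next
  case (const c)
  show ?case by (intro exI[of _ 0] exI[of _ "\<lambda>_. c"]) (simp add: form_const)
next
  case (add f g)
  then obtain d p e q where "form I d p" "form I e q"
    and "\<forall>x\<in>D. f x = p (bary x)" "\<forall>x\<in>D. g x = q (bary x)" by blast
  moreover from this have "form I (d + e) (\<lambda>t. p t * sum t I ^ e + q t * sum t I ^ d)"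
    using form_add[OF form_pad[OF finite_vertices I, of d p e], of "\<lambda>t. q t * sum t I ^ d"]
      form_pad[OF finite_vertices I, of e q d]
    by (simp add: add.commute)
  ultimately show ?case
    by (intro exI[of _ "d + e"] exI[of _ "\<lambda>t. p t * sum t I ^ e + q t * sum t I ^ d"])
      (simp add: sum_bary)
next
  case (mult f g)
  then obtain d p e q where "form I d p" "form I e q"
    and "\<forall>x\<in>D. f x = p (bary x)" "\<forall>x\<in>D. g x = q (bary x)" by blast
  then show ?case
    by (intro exI[of _ "d + e"] exI[of _ "\<lambda>t. p t * q t"]) (simp add: form_mult)
qed

text \<open>Simplices are added one at a time. The new polynomial and the form built so far both
  represent \<open>F\<close> on common faces, so their difference on \<open>V\<close> extends by 0
  to the earlier simplices and can be added as a correction.\<close>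

lemma C0_form_subcomplex:
  assumes F: "\<forall>V\<in>K. \<exists>g. real_polynomial_function g \<and> (\<forall>x\<in>convex hull V. F x = g x)"
    and I: "I \<noteq> {}" and "finite \<W>" "\<W> \<subseteq> K"
  shows "\<exists>d p. form I d p \<and> (\<forall>V\<in>\<W>. \<forall>x\<in>convex hull V. F x = p (bary x))"
  using assms(3,4)
proof (induction \<W>)
  case empty
  show ?case using form_const by blast
next
  case (insert V \<W>)
  then obtain d p where p: "form I d p" "\<And>W x. \<lbrakk>W \<in> \<W>; x \<in> convex hull W\<rbrakk> \<Longrightarrow> F x = p (bary x)"
    by auto
  have V: "V \<in> K" using insert.prems by simp
  from bspec[OF F V] obtain g where g: "real_polynomial_function g" "\<forall>x\<in>convex hull V. F x = g x"
    by (elim exE conjE)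
  obtain e q where q: "form I e q" "\<forall>x\<in>D. g x = q (bary x)"
    using polynomial_form[OF g(1) I] by blast
  have Fq: "F x = q (bary x)" if "x \<in> convex hull V" for x
    using that g(2) q(2) simplexD(4)[OF V] by (simp add: subsetD)
  \<comment> \<open>The extra \<open>Suc\<close> makes the degree positive, so that \<open>h\<close>
    vanishes at the origin, which cannot be rescaled into the standard simplex.\<close>
  define k where "k = Suc (d + e)"
  define p' where "p' t = p t * sum t I ^ Suc e" for t
  define h where "h t = q t * sum t I ^ Suc d - p' t" for t
  have p': "form I k p'"
    using form_pad[OF finite_vertices I p(1), of "Suc e"] by (simp add: k_def p'_def [abs_def])
  have h: "form I k h"
    using form_diff[OF _ p', of "\<lambda>t. q t * sum t I ^ Suc d"]
      form_pad[OF finite_vertices I q(1), of "Suc d"]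
    by (simp add: k_def h_def [abs_def] add.commute)
  have "h t = 0" if W: "W \<in> \<W>" and t: "\<forall>w. 0 \<le> t w" "\<forall>w. w \<notin> V \<inter> W \<longrightarrow> t w = 0" for W t
  proof -
    \<comment> \<open>The values of \<open>h\<close> are known at barycentric coordinates only;
      dividing by the coordinate sum moves \<open>t\<close> there, and homogeneity brings the result
      back.\<close>
    define c where "c = sum t I"
    define t' where "t' = (\<lambda>w. t w / c)"
    have ht: "h t = c ^ k * h t'" if "c \<noteq> 0 \<or> (\<forall>w. t w = 0)"
    proof -
      have "t = (\<lambda>w. c * t' w)" using that by (auto simp: t'_def)
      then show ?thesis using form_homogeneous[OF h, of c t'] by simp
    qed
    show ?thesis
    proof (cases "c = 0")
      case True
      then have "\<forall>w\<in>I. t w = 0"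
        using sum_nonneg_eq_0_iff[OF finite_vertices, of t] t(1) by (simp add: c_def)
      then have "\<forall>w. t w = 0" using t(2) simplexD(3)[OF V] by blast
      then show ?thesis using ht True by (simp add: k_def)
    next
      case False
      then have "c > 0" using t(1) sum_nonneg[of I t] by (simp add: c_def less_le)
      then have "t' \<in> std_simplex I"
        using t simplexD(3)[OF V] by (auto simp: std_simplex_def t'_def c_def sum_divide_distrib[symmetric])
      then obtain x where x: "x \<in> convex hull (V \<inter> W)" "bary x = t'"
        using bary_surj[OF V, of t' "V \<inter> W"] t(2) by (auto simp: t'_def)
      have "x \<in> convex hull V" "x \<in> convex hull W"
        using x(1) hull_mono[of "V \<inter> W"] by blast+
      moreover from this have "sum (bary x) I = 1"
        using simplexD(4)[OF V] sum_bary by blast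
      ultimately have "h t' = 0"
        using p(2)[OF W, of x] Fq[of x] by (simp add: h_def p'_def flip: x(2))
      then show ?thesis using ht False by simp
    qed
  qed
  then have vanish: "\<forall>W\<in>\<W>. \<forall>t. (\<forall>w. 0 \<le> t w) \<longrightarrow> (\<forall>w. w \<notin> V \<inter> W \<longrightarrow> t w = 0) \<longrightarrow> h t = 0" by blast
  obtain i where i: "i \<in> I" using I by blast
  from form_vanishing_extension[OF insert.hyps(1) h i vanish] obtain r where r: "form I k r"
    and rV: "\<forall>t. (\<forall>w. 0 \<le> t w) \<longrightarrow> (\<forall>w. w \<notin> V \<longrightarrow> t w = 0) \<longrightarrow> r t = h t"
    and r0: "\<forall>W\<in>\<W>. \<forall>t. (\<forall>w. w \<notin> W \<longrightarrow> t w = 0) \<longrightarrow> r t = 0"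
    by (elim exE conjE)
  have "F x = p' (bary x) + r (bary x)" if W: "W \<in> insert V \<W>" and x: "x \<in> convex hull W" for W x
  proof -
    have WK: "W \<in> K" using W insert.prems by auto
    have s: "sum (bary x) I = 1" using sum_bary simplexD(4)[OF WK] x by blast
    show ?thesis
    proof (cases "W \<in> \<W>")
      case True
      then have "r (bary x) = 0" using r0 bary_in_simplex(2)[OF WK x] by simp
      then show ?thesis using p(2)[OF True x] s by (simp add: p'_def)
    next
      case False
      then have "W = V" using W by simp
      then have "r (bary x) = h (bary x)"
        using bary_in_simplex(1,2)[OF WK x] rV by (simp add: std_simplex_def)
      then show ?thesis using Fq x s \<open>W = V\<close> by (simp add: h_def)
    qed
  qed
  then show ?case using form_add[OF p' r] by blast
qed

lemma C0_form:
  assumes "F \<in> C0 K" and "I \<noteq> {}"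
  shows "\<exists>d p. form I d p \<and> (\<forall>x\<in>D. F x = p (bary x))"
proof -
  have "\<forall>V\<in>K. \<exists>g. real_polynomial_function g \<and> (\<forall>x\<in>convex hull V. F x = g x)"
    using assms(1) by (simp add: C0_def)
  from C0_form_subcomplex[OF this assms(2) finite_K order_refl] show ?thesis
    unfolding realization_def by blast
qed

text \<open>The form \<open>G\<close> below vanishes exactly on the faces of the standard simplex that belong to the
  complex, so a large multiple of it repairs positivity off the complex.\<close>

lemma form_positive_extension:
  assumes p: "form I d p" and I: "I \<noteq> {}" and pos: "\<And>x. x \<in> D \<Longrightarrow> p (bary x) > 0"
  shows "\<exists>e q \<mu>. form I e q \<and> (\<forall>x\<in>D. q (bary x) = p (bary x)) \<and>
           \<mu> > 0 \<and> (\<forall>t\<in>std_simplex I. q t \<ge> \<mu>)"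
proof -
  define G where "G t = (\<Prod>V\<in>K. \<Sum>w\<in>I - V. t w)" for t :: "'a \<Rightarrow> real"
  obtain i where i: "i \<in> I" using I by blast
  have "form I 1 (\<lambda>t. \<Sum>w\<in>I - V. t w)" for V
    using form_linear[of "I - V" I i "\<lambda>_. 1"] i finite_vertices by simp
  then have G: "form I (card K) G"
    using form_prod[OF finite_K, of I 1 "\<lambda>V t. \<Sum>w\<in>I - V. t w"] by (simp add: G_def [abs_def])
  have G_nonneg: "G t \<ge> 0" if "t \<in> std_simplex I" for t
    using that by (auto simp: G_def std_simplex_def intro!: prod_nonneg sum_nonneg)
  have G_bary: "G (bary x) = 0" if x: "x \<in> D" for x
  proof -
    obtain V where V: "V \<in> K" "x \<in> convex hull V" using x by (auto simp: realization_def)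
    then have "(\<Sum>w\<in>I - V. bary x w) = 0"
      using bary_in_simplex(2) by (intro sum.neutral) blast
    then show ?thesis unfolding G_def using V(1) finite_K by (intro prod_zero) auto
  qed
  have G_pos: "G t > 0" if t: "t \<in> std_simplex I" "p t \<le> 0" for t
  proof (rule ccontr)
    assume "\<not> G t > 0"
    then have "G t = 0" using G_nonneg[OF t(1)] by simp
    then obtain V where V: "V \<in> K" "(\<Sum>w\<in>I - V. t w) = 0"
      unfolding G_def prod_zero_iff[OF finite_K] by (elim bexE)
    have "finite (I - V)" using finite_vertices by simp
    moreover have "\<And>w. w \<in> I - V \<Longrightarrow> 0 \<le> t w" using t(1) by (simp add: std_simplex_def)
    ultimately have "\<forall>w\<in>I - V. t w = 0"
      using sum_nonneg_eq_0_iff[of "I - V" t] V(2) by blast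
    \<comment> \<open>\<open>t\<close> is now supported on one simplex, hence consists of the
      coordinates of a point of \<open>D\<close>, where \<open>p\<close> is positive.\<close>
    then have "t w = 0" if "w \<notin> V" for w using that t(1) by (auto simp: std_simplex_def)
    then have "\<exists>x\<in>convex hull V. bary x = t"
      by (intro bary_surj[OF V(1) t(1)]) simp_all
    then obtain x where "x \<in> convex hull V" "bary x = t" by (elim bexE)
    then show False using pos[of x] simplexD(4)[OF V(1)] t(2) by auto
  qed
  have comp: "compact (std_simplex I)" by (rule compact_std_simplex[OF finite_vertices])
  have i1: "(\<lambda>w. if w = i then 1 else 0) \<in> std_simplex I"
    using i finite_vertices by (auto simp: std_simplex_def)
  have "continuous_on (std_simplex I) p"
    using form_continuous[OF p] continuous_on_subset by blast
  then obtain t0 where t0: "\<forall>t\<in>std_simplex I. p t0 \<le> p t"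
    using continuous_attains_inf[OF comp, of p] i1 by blast
  have "\<exists>g>0. \<forall>t\<in>std_simplex I. p t \<le> 0 \<longrightarrow> g \<le> G t"
  proof (cases "std_simplex I \<inter> {t. p t \<le> 0} = {}")
    case True
    \<comment> \<open>Here \<open>p\<close> is positive on the whole standard simplex, and any
      positive \<open>g\<close> will do.\<close>
    then show ?thesis by (intro exI[of _ 1]) auto
  next
    case False
    have "closed {t. p t \<le> 0}"
      using form_continuous[OF p] by (intro closed_Collect_le) auto
    then have "compact (std_simplex I \<inter> {t. p t \<le> 0})"
      using comp by (rule compact_Int_closed[rotated])
    moreover have "continuous_on (std_simplex I \<inter> {t. p t \<le> 0}) G"
      using form_continuous[OF G] continuous_on_subset by blast
    ultimately obtain t1 where "t1 \<in> std_simplex I \<inter> {t. p t \<le> 0}"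
      "\<forall>t\<in>std_simplex I \<inter> {t. p t \<le> 0}. G t1 \<le> G t"
      using continuous_attains_inf False by blast
    then show ?thesis using G_pos by (intro exI[of _ "G t1"]) auto
  qed
  then obtain g where g: "g > 0" "\<And>t. \<lbrakk>t \<in> std_simplex I; p t \<le> 0\<rbrakk> \<Longrightarrow> g \<le> G t" by blast
  \<comment> \<open>\<open>\<bar>p t0\<bar> + 1\<close> exceeds the largest possible deficit of
    \<open>p\<close>, and \<open>G\<close> is at least \<open>g\<close> wherever there is a
    deficit.\<close>
  define C where "C = (\<bar>p t0\<bar> + 1) / g"
  have C: "C > 0" using g(1) by (simp add: C_def)
  define q where "q t = p t * sum t I ^ card K + C * (G t * sum t I ^ d)" for t
  have q: "form I (d + card K) q"
    using form_add[OF form_pad[OF finite_vertices I p, of "card K"],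
        of "\<lambda>t. C * (G t * sum t I ^ d)"]
      form_scale[OF form_pad[OF finite_vertices I G, of d], of C]
    by (simp add: q_def [abs_def] add.commute)
  have q_eq: "q t = p t + C * G t" if "t \<in> std_simplex I" for t
    using that by (simp add: q_def std_simplex_def)
  have q_pos: "q t > 0" if t: "t \<in> std_simplex I" for t
  proof (cases "p t \<le> 0")
    case True
    have "C * G t \<ge> C * g" using g(2)[OF t True] C by simp
    moreover have "C * g = \<bar>p t0\<bar> + 1" using g(1) by (simp add: C_def)
    ultimately show ?thesis using t0 t q_eq[OF t] by fastforce
  next
    case False
    then show ?thesis using q_eq[OF t] G_nonneg[OF t] C by (simp add: add_pos_nonneg)
  qed
  have "continuous_on (std_simplex I) q"
    using form_continuous[OF q] continuous_on_subset by blast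
  then obtain t2 where t2: "t2 \<in> std_simplex I" "\<forall>t\<in>std_simplex I. q t2 \<le> q t"
    using continuous_attains_inf[OF comp, of q] i1 by blast
  moreover have "\<forall>x\<in>D. q (bary x) = p (bary x)"
    by (simp add: q_eq bary_std_simplex G_bary)
  ultimately show ?thesis using q q_pos by blast
qed

section \<open>The quadratic module generated by the tent functions\<close>

definition A :: "('a \<Rightarrow> real) set" where
  "A = {f. continuous_on D f \<and>
         (\<forall>V\<in>K. \<exists>g. real_polynomial_function g \<and> (\<forall>x\<in>convex hull V. f x = g x))}"

text \<open>Here, in \<open>A\<close> and in \<open>M\<close>, only the values on \<open>D\<close>
  matter. Dropping extensionality makes these sets closed under pointwise operations on total
  functions; restriction to \<open>D\<close> leads back to \<open>C0\<close>.\<close>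

definition sos :: "('a \<Rightarrow> real) set" where
  "sos = {f. \<exists>(N::nat) h. (\<forall>j<N. h j \<in> A) \<and> (\<forall>x\<in>D. f x = (\<Sum>j<N. (h j x)\<^sup>2))}"

definition M :: "('a \<Rightarrow> real) set" where
  "M = {f. \<exists>S\<^sub>0 S. S\<^sub>0 \<in> sos \<and> (\<forall>w\<in>I. S w \<in> sos) \<and>
         (\<forall>x\<in>D. f x = S\<^sub>0 x + (\<Sum>w\<in>I. S w x * tent K w x))}"

lemma A_polynomial:
  "\<lbrakk>f \<in> A; V \<in> K\<rbrakk> \<Longrightarrow> \<exists>g. real_polynomial_function g \<and> (\<forall>x\<in>convex hull V. f x = g x)"
  by (simp add: A_def)

lemma C0_A: "f \<in> C0 K \<Longrightarrow> f \<in> A"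
  by (simp add: C0_def A_def)

lemma A_cong:
  assumes "f \<in> A" "\<And>x. x \<in> D \<Longrightarrow> g x = f x"
  shows "g \<in> A"
proof -
  have "continuous_on D g \<longleftrightarrow> continuous_on D f"
    using assms(2) by (intro continuous_on_cong) auto
  moreover have "\<forall>V\<in>K. \<forall>x\<in>convex hull V. g x = f x"
    using assms(2) simplexD(4) by blast
  ultimately show ?thesis using assms(1) unfolding A_def by auto
qed

lemma A_C0: "f \<in> A \<Longrightarrow> restrict f D \<in> C0 K"
  using A_cong[of f "restrict f D"] by (simp add: C0_def A_def)

lemma sos_sums_of_squares: "f \<in> sos \<Longrightarrow> restrict f D \<in> sums_of_squares K"
proof -
  assume "f \<in> sos"
  then obtain N :: nat and h where h: "\<forall>j<N. h j \<in> A" "\<forall>x\<in>D. f x = (\<Sum>j<N. (h j x)\<^sup>2)"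
    by (auto simp: sos_def)
  then show ?thesis unfolding sums_of_squares_def
    by (intro CollectI exI[of _ N] exI[of _ "\<lambda>j. restrict (h j) D"]) (auto simp: A_C0 fun_eq_iff)
qed

lemma const_in_A: "(\<lambda>x. c) \<in> A"
  unfolding A_def by (auto intro: real_polynomial_function.intros(2))

lemma add_in_A:
  assumes "f \<in> A" "g \<in> A"
  shows "(\<lambda>x. f x + g x) \<in> A"
proof -
  have "\<exists>r. real_polynomial_function r \<and> (\<forall>x\<in>convex hull V. f x + g x = r x)" if "V \<in> K" for V
  proof -
    from A_polynomial[OF assms(1) that] A_polynomial[OF assms(2) that]
    obtain p q where "real_polynomial_function p" "\<forall>x\<in>convex hull V. f x = p x"
      and "real_polynomial_function q" "\<forall>x\<in>convex hull V. g x = q x"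
      by (elim exE conjE)
    then show ?thesis using real_polynomial_function.intros(3) by (intro exI[of _ "\<lambda>x. p x + q x"]) auto
  qed
  then show ?thesis using assms by (auto simp: A_def intro: continuous_on_add)
qed

lemma mult_in_A:
  assumes "f \<in> A" "g \<in> A"
  shows "(\<lambda>x. f x * g x) \<in> A"
proof -
  have "\<exists>r. real_polynomial_function r \<and> (\<forall>x\<in>convex hull V. f x * g x = r x)" if "V \<in> K" for V
  proof -
    from A_polynomial[OF assms(1) that] A_polynomial[OF assms(2) that]
    obtain p q where "real_polynomial_function p" "\<forall>x\<in>convex hull V. f x = p x"
      and "real_polynomial_function q" "\<forall>x\<in>convex hull V. g x = q x"
      by (elim exE conjE)
    then show ?thesis using real_polynomial_function.intros(4) by (intro exI[of _ "\<lambda>x. p x * q x"]) auto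
  qed
  then show ?thesis using assms by (auto simp: A_def intro: continuous_on_mult)
qed

lemma sum_in_A:
  assumes "\<And>i. i \<in> J \<Longrightarrow> f i \<in> A"
  shows "(\<lambda>x. \<Sum>i\<in>J. f i x) \<in> A"
  using assms
proof (induction J rule: infinite_finite_induct)
  case (insert i J)
  then show ?case using add_in_A[of "f i" "\<lambda>x. \<Sum>i\<in>J. f i x"] by simp
qed (auto intro: const_in_A)

lemma sos_A:
  assumes "f \<in> sos"
  shows "f \<in> A"
proof -
  obtain N :: nat and h where h: "\<forall>j<N. h j \<in> A" "\<forall>x\<in>D. f x = (\<Sum>j<N. (h j x)\<^sup>2)"
    using assms by (auto simp: sos_def)
  have "(\<lambda>x. \<Sum>j<N. h j x * h j x) \<in> A"
    using h(1) by (intro sum_in_A mult_in_A) auto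
  then show ?thesis by (rule A_cong) (use h(2) in \<open>simp add: power2_eq_square\<close>)
qed

lemma sos_add:
  assumes "f \<in> sos" "g \<in> sos"
  shows "(\<lambda>x. f x + g x) \<in> sos"
proof -
  obtain N :: nat and h where h: "\<forall>j<N. h j \<in> A" "\<forall>x\<in>D. f x = (\<Sum>j<N. (h j x)\<^sup>2)"
    using assms by (auto simp: sos_def)
  obtain N' :: nat and h' where h': "\<forall>j<N'. h' j \<in> A" "\<forall>x\<in>D. g x = (\<Sum>j<N'. (h' j x)\<^sup>2)"
    using assms by (auto simp: sos_def)
  have "(\<Sum>j<N + N'. ((if j < N then h j else h' (j - N)) x)\<^sup>2) = f x + g x" if "x \<in> D" for x
  proof -
    have "(\<Sum>j<N + N'. ((if j < N then h j else h' (j - N)) x)\<^sup>2) =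
        (\<Sum>j<N + N'. if j < N then (h j x)\<^sup>2 else (h' (j - N) x)\<^sup>2)"
      by (intro sum.cong refl) simp
    then show ?thesis
      using that h(2) h'(2) sum_append[where f = "\<lambda>j. (h j x)\<^sup>2" and g = "\<lambda>j. (h' j x)\<^sup>2"] by simp
  qed
  then show ?thesis
    using h(1) h'(1) unfolding sos_def
    by (intro CollectI exI[of _ "N + N'"] exI[of _ "\<lambda>j. if j < N then h j else h' (j - N)"]) auto
qed

lemma sos_square_mult:
  assumes "k \<in> A" "f \<in> sos"
  shows "(\<lambda>x. (k x)\<^sup>2 * f x) \<in> sos"
proof -
  obtain N :: nat and h where h: "\<forall>j<N. h j \<in> A" "\<forall>x\<in>D. f x = (\<Sum>j<N. (h j x)\<^sup>2)"
    using assms by (auto simp: sos_def)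
  then show ?thesis
    using assms(1) unfolding sos_def
    by (intro CollectI exI[of _ N] exI[of _ "\<lambda>j x. k x * h j x"])
      (auto intro: mult_in_A simp: power_mult_distrib sum_distrib_left)
qed

lemma sos_zero: "(\<lambda>x. 0) \<in> sos"
  unfolding sos_def by (intro CollectI exI[of _ 0]) simp

lemma sos_one: "(\<lambda>x. 1) \<in> sos"
  unfolding sos_def by (intro CollectI exI[of _ 1] exI[of _ "\<lambda>_ _. 1"]) (simp add: const_in_A)

lemma tent_A: "w \<in> I \<Longrightarrow> tent K w \<in> A"
  using is_tent_tent[OF complex] by (auto simp: is_tent_def intro: C0_A)

lemma M_representation:
  "f \<in> M \<Longrightarrow> \<exists>S\<^sub>0 S. S\<^sub>0 \<in> sos \<and> (\<forall>w\<in>I. S w \<in> sos) \<and>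
     (\<forall>x\<in>D. f x = S\<^sub>0 x + (\<Sum>w\<in>I. S w x * tent K w x))"
  by (simp add: M_def)

lemma quadratic_module_tents: "quadratic_module D A M"
proof
  show "M \<subseteq> A"
  proof
    fix f assume "f \<in> M"
    from M_representation[OF this] obtain S0 S where S: "S0 \<in> sos" "\<forall>w\<in>I. S w \<in> sos"
      "\<forall>x\<in>D. f x = S0 x + (\<Sum>w\<in>I. S w x * tent K w x)"
      by (elim exE conjE)
    have "(\<lambda>x. S0 x + (\<Sum>w\<in>I. S w x * tent K w x)) \<in> A"
      using S(1,2) by (intro add_in_A sum_in_A mult_in_A tent_A sos_A) auto
    then show "f \<in> A" by (rule A_cong) (use S(3) in simp)
  qed
  show "g \<in> M" if "f \<in> M" "\<And>x. x \<in> D \<Longrightarrow> g x = f x" for f g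
    using that unfolding M_def by auto
  show "(\<lambda>x. 1) \<in> M"
    unfolding M_def
    by (intro CollectI exI[of _ "\<lambda>x. 1"] exI[of _ "\<lambda>w x. 0"]) (simp add: sos_one sos_zero)
  show "(\<lambda>x. f x + g x) \<in> M" if f: "f \<in> M" and g: "g \<in> M" for f g
  proof -
    obtain S0 S where S: "S0 \<in> sos" "\<forall>w\<in>I. S w \<in> sos"
      "\<forall>x\<in>D. f x = S0 x + (\<Sum>w\<in>I. S w x * tent K w x)" using M_representation[OF f] by (elim exE conjE)
    obtain R0 R where R: "R0 \<in> sos" "\<forall>w\<in>I. R w \<in> sos"
      "\<forall>x\<in>D. g x = R0 x + (\<Sum>w\<in>I. R w x * tent K w x)" using M_representation[OF g] by (elim exE conjE)
    show ?thesis
      unfolding M_def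
      by (intro CollectI exI[of _ "\<lambda>x. S0 x + R0 x"] exI[of _ "\<lambda>w x. S w x + R w x"])
        (use S R in \<open>auto simp: sos_add sum.distrib algebra_simps\<close>)
  qed
  show "(\<lambda>x. (h x)\<^sup>2 * f x) \<in> M" if h: "h \<in> A" and f: "f \<in> M" for h f
  proof -
    obtain S0 S where S: "S0 \<in> sos" "\<forall>w\<in>I. S w \<in> sos"
      "\<forall>x\<in>D. f x = S0 x + (\<Sum>w\<in>I. S w x * tent K w x)" using M_representation[OF f] by (elim exE conjE)
    show ?thesis
      unfolding M_def
      by (intro CollectI exI[of _ "\<lambda>x. (h x)\<^sup>2 * S0 x"] exI[of _ "\<lambda>w x. (h x)\<^sup>2 * S w x"])
        (use S h in \<open>auto simp: sos_square_mult sum_distrib_left distrib_left mult.assoc\<close>)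
  qed
qed (auto intro: const_in_A add_in_A mult_in_A)

sublocale quadratic_module D A M
  by (rule quadratic_module_tents)

lemma tent_M:
  assumes "w \<in> I"
  shows "tent K w \<in> M"
  unfolding M_def
proof (intro CollectI exI[of _ "\<lambda>x. 0"] exI[of _ "\<lambda>u x. if u = w then 1 else 0"] conjI ballI)
  show "(\<lambda>x. if u = w then 1 else 0) \<in> sos" for u
    by (cases "u = w") (simp_all add: sos_one sos_zero)
  have "(\<Sum>u\<in>I. (if u = w then 1 else 0) * tent K u x) = (\<Sum>u\<in>I. if u = w then tent K u x else 0)" for x
    by (intro sum.cong refl) simp
  then show "tent K w x = 0 + (\<Sum>u\<in>I. (if u = w then 1 else 0) * tent K u x)" for x
    using assms finite_vertices by simp
qed (rule sos_zero)

text \<open>The upper bound is the archimedean ingredient: since the coordinates sum to 1 on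
  \<open>D\<close>, the complement of one tent function is the sum of the others.\<close>

lemma bary_M:
  assumes w: "w \<in> I"
  shows "(\<lambda>x. bary x w) \<in> M" "(\<lambda>x. 1 - bary x w) \<in> M"
proof -
  have b: "(\<lambda>x. bary x u) \<in> M" if "u \<in> I" for u
    using tent_M[OF that] that by (simp add: bary_def)
  then show "(\<lambda>x. bary x w) \<in> M" using w .
  have "(\<lambda>x. \<Sum>u\<in>I - {w}. bary x u) \<in> M"
    by (intro M_sum b) auto
  then show "(\<lambda>x. 1 - bary x w) \<in> M"
    by (rule M_cong) (use w finite_vertices sum_bary in \<open>simp add: sum_diff1\<close>)
qed

lemma positive_in_M:
  assumes F: "F \<in> C0 K" and pos: "\<forall>x\<in>D. F x > 0"
  shows "F \<in> M"
proof (cases "D = {}")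
  \<comment> \<open>An empty complex has no vertices, hence no forms of positive degree; membership
    in \<open>M\<close> is vacuous there.\<close>
  case True
  show ?thesis by (rule M_cong[OF M_one]) (simp add: True)
next
  case False
  then have I: "I \<noteq> {}"
    using simplexD(2,3) by (force simp: realization_def)
  obtain d p where p: "form I d p" "\<forall>x\<in>D. F x = p (bary x)"
    using C0_form[OF F I] by blast
  have "compact D"
    unfolding realization_def
    using finite_K simplexD(1) by (intro compact_UN finite_imp_compact_convex_hull) auto
  moreover have "continuous_on D F" using F by (simp add: C0_def)
  ultimately obtain x0 where x0: "x0 \<in> D" "\<forall>x\<in>D. F x0 \<le> F x"
    using continuous_attains_inf[OF _ False] by blast
  \<comment> \<open>Half the minimum of \<open>F\<close> keeps \<open>F - \<epsilon>\<close>
    strictly positive and leaves \<open>\<epsilon>\<close> in reserve for the products.\<close>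
  define \<epsilon> where "\<epsilon> = F x0 / 2"
  have \<epsilon>: "\<epsilon> > 0" using pos x0(1) by (simp add: \<epsilon>_def)
  have p\<epsilon>: "form I d (\<lambda>t. p t - \<epsilon> * sum t I ^ d)"
    using form_diff[OF p(1), of "\<lambda>t. \<epsilon> * sum t I ^ d"]
      form_pad[OF finite_vertices I form_const[of I "\<epsilon>"], of d] by simp
  have "p (bary x) - \<epsilon> * sum (bary x) I ^ d > 0" if "x \<in> D" for x
    using that x0 \<epsilon> p(2) by (force simp: sum_bary \<epsilon>_def)
  then obtain e q \<mu> where q: "form I e q" "\<forall>x\<in>D. q (bary x) = p (bary x) - \<epsilon> * sum (bary x) I ^ d"
    and \<mu>: "\<mu> > 0" "\<And>t. t \<in> std_simplex I \<Longrightarrow> \<mu> \<le> q t"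
    using form_positive_extension[OF p\<epsilon> I] by blast
  obtain n c where c: "\<And>s. s \<in> {..<n::nat} \<rightarrow>\<^sub>E I \<Longrightarrow> c s \<ge> 0"
    and qc: "\<And>t. t \<in> std_simplex I \<Longrightarrow> q t = (\<Sum>s\<in>{..<n} \<rightarrow>\<^sub>E I. c s * (\<Prod>l<n. t (s l)))"
    using polya[OF finite_vertices q(1) \<mu>] by blast
  let ?W = "{..<n} \<rightarrow>\<^sub>E I"
  \<comment> \<open>\<open>\<epsilon>\<close> is shared out: each product of weight
    \<open>c s\<close> receives \<open>\<delta> * c s\<close>, and one further
    \<open>\<delta>\<close> is left over. The summand 1 keeps the denominator positive.\<close>
  define \<delta> where "\<delta> = \<epsilon> / (1 + sum c ?W)"
  have sc: "sum c ?W \<ge> 0" using c by (rule sum_nonneg)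
  have \<delta>: "\<delta> > 0" "\<epsilon> - \<delta> * sum c ?W = \<delta>"
    using \<epsilon> sc by (auto simp: \<delta>_def field_simps)
  \<comment> \<open>The factors are indexed by positions in the word, because a vertex may occur
    repeatedly.\<close>
  have "(\<lambda>x. (\<Prod>l<n. bary x (s l)) + \<delta>) \<in> M" if "s \<in> ?W" for s
    using prod_plus_const_in_M[of "{..<n}" "\<lambda>l x. bary x (s l)"] that bary_M \<delta>(1) by (auto simp: PiE_iff)
  then have "(\<lambda>x. \<Sum>s\<in>?W. c s * ((\<Prod>l<n. bary x (s l)) + \<delta>)) \<in> M"
    using c by (intro M_sum M_scale)
  then have "(\<lambda>x. (\<Sum>s\<in>?W. c s * ((\<Prod>l<n. bary x (s l)) + \<delta>)) + \<delta>) \<in> M"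
    by (rule M_add) (use \<delta>(1) in \<open>simp add: M_const\<close>)
  then show ?thesis
  proof (rule M_cong)
    fix x assume x: "x \<in> D"
    have "F x = q (bary x) + \<epsilon>"
      using q(2) p(2) x by (simp add: sum_bary)
    also have "\<dots> = (\<Sum>s\<in>?W. c s * (\<Prod>l<n. bary x (s l))) + \<delta> * sum c ?W + \<delta>"
      using qc[OF bary_std_simplex[OF x]] \<delta>(2) by simp
    also have "\<dots> = (\<Sum>s\<in>?W. c s * ((\<Prod>l<n. bary x (s l)) + \<delta>)) + \<delta>"
      by (simp add: distrib_left sum.distrib sum_distrib_left mult.commute)
    finally show "F x = (\<Sum>s\<in>?W. c s * ((\<Prod>l<n. bary x (s l)) + \<delta>)) + \<delta>" .
  qed
qed

end

theorem corollary2p2: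
  fixes K :: "(real ^ 'n) set set"
    and m :: nat
    and v :: "nat \<Rightarrow> real ^ 'n"
    and F :: "real ^ 'n \<Rightarrow> real"
  assumes "complex_of_simplices K"
    and "bij_betw v {1..m} (complex_vertices K)"
    and "F \<in> C0 K"
    and "\<forall>x\<in>realization K. F x > 0"
  shows "\<exists>S :: nat \<Rightarrow> real ^ 'n \<Rightarrow> real.
           (\<forall>i\<in>{0..m}. S i \<in> sums_of_squares K) \<and>
           F = (\<lambda>x\<in>realization K. S 0 x + (\<Sum>i=1..m. S i x * tent K (v i) x))"
proof -
  interpret geometric_complex K by unfold_locales fact
  obtain S0 S where S: "S0 \<in> sos" "\<forall>w\<in>complex_vertices K. S w \<in> sos"
    and F: "\<forall>x\<in>realization K. F x = S0 x + (\<Sum>w\<in>complex_vertices K. S w x * tent K w x)"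
    using M_representation[OF positive_in_M[OF assms(3,4)]] by (elim exE conjE)
  \<comment> \<open>Vertices are numbered from 1, which leaves index 0 for the free term;
    restriction makes every \<open>R i\<close> extensional, as \<open>sums_of_squares\<close>
    demands.\<close>
  define R where "R i = restrict (if i = 0 then S0 else S (v i)) (realization K)" for i
  have "R i \<in> sums_of_squares K" if "i \<in> {0..m}" for i
    using that S bij_betwE[OF assms(2)] by (auto simp: R_def intro!: sos_sums_of_squares)
  moreover have "F x = (\<lambda>x\<in>realization K. R 0 x + (\<Sum>i=1..m. R i x * tent K (v i) x)) x" for x
  proof (cases "x \<in> realization K")
    case True
    have "(\<Sum>w\<in>complex_vertices K. S w x * tent K w x) = (\<Sum>i=1..m. S (v i) x * tent K (v i) x)"
      by (rule sum.reindex_bij_betw[OF assms(2), symmetric])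
    also have "\<dots> = (\<Sum>i=1..m. R i x * tent K (v i) x)"
      using True by (intro sum.cong refl) (simp add: R_def)
    finally show ?thesis using F True by (simp add: R_def)
  next
    case False
    then show ?thesis using assms(3) by (simp add: C0_def extensional_def)
  qed
  ultimately show ?thesis by blast
qed

end
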